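(* Consider the case without line thermal limits, as described in the context, and assume Assumptions 1 and 2 hold. Then for the DPPD dynamics (without line limits): 1) if $d(0)\in\Omega$, then $d_i(t)\in\Omega_i$ for all $i\in\mathcal N$ and all $t\ge0$; 2) every trajectory $(\eta,d,\hat\theta,P,\omega,\mu)$ is bounded; 3) every trajectory $(\eta,d,\hat\theta,P,\omega,\mu)$ converges globally and asymptotically to an equilibrium point $(\eta^*,d^*,\hat\theta^*,P^*,\omega^*,\mu^* )$ of the dynamics, where $(d^*,\hat\theta^*,P^*,\omega^* )$ is an optimal solution of the ROLC problem (without line limits).
   Context: Power network: a directed connected graph $\mathcal G(\mathcal N,\mathcal E)$ with buses $\mathcal N=\{1,\dots,n\}$ and lines $\mathcal E\subseteq\mathcal N\times\mathcal N$. Each line $ij$ has susceptance $B_{ij}>0$; each bus has damping $D_i>0$ and a given constant power injection $P_i^{in}\in\mathbb R$. For $x\in\mathbb R^n$ write $x_{ij}=x_i-x_j$. Costs: $f_i=f_{i,0}+f_{i,1}+f_{i,2}$, where $f_{i,0}:\mathbb R\to\mathbb R$ is differentiable, $f_{i,1}$ is the indicator function of $\Omega_i=[\underline d_i,\overline d_i]$ ($0$ on $\Omega_i$, $+\infty$ outside), and $f_{i,2}:\mathbb R\to\mathbb R$ is lower semicontinuous convex; $\Omega=\Omega_1\times\dots\times\Omega_n$. Assumption 1: each $f_{i,0}$ is $\beta$-strongly convex with $\beta>1$. Assumption 2 (Slater): there exist $\tilde d\in\mathrm{relint}(\Omega)$ and $\tilde\theta\in\mathbb R^n$ with $0=P_i^{in}-\tilde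 d_i+\sum_{k:ki\in\mathcal E}B_{ki}\tilde\theta_{ki}-\sum_{j:ij\in\mathcal E}B_{ij}\tilde\theta_{ij}$ for all $i$ and $\underline P_{ij}<B_{ij}\tilde\theta_{ij}<\overline P_{ij}$ for all $ij\in\mathcal E$ (for given line limits $\underline P_{ij}\le\overline P_{ij}$). ROLC problem without line limits: minimize over $d,\hat\theta,\omega\in\mathbb R^n$, $P=(P_{ij})_{ij\in\mathcal E}$ the function $\sum_i\big(f_i(d_i)+\tfrac{D_i}{2}\omega_i^2\big)$ subject to, for all $i\in\mathcal N$, $0=P_i^{in}-D_i\omega_i-d_i+\sum_{k:ki\in\mathcal E}P_{ki}-\sum_{j:ij\in\mathcal E}P_{ij}$ and $0=P_i^{in}-d_i+\sum_{k:ki\in\mathcal E}B_{ki}\hat\theta_{ki}-\sum_{j:ij\in\mathcal E}B_{ij}\hat\theta_{ij}$. Proximal operator: $\mathbf{prox}_{g}(y)=\arg\min_x\{g(x)+\tfrac12\|x-y\|^2\}$. DPPD dynamics without line limits (fixed constant $\kappa\in(0,1)$): with $u_{i,1}=P_i^{in}-d_i-D_i\omega_i+\sum_{k:ki\in\mathcal E}P_{ki}-\sum_{j:ij\in\mathcal E}P_{ij}$ and $u_{i,2}=P_i^{in}-d_i+\sum_{k:ki\in\mathcal E}B_{ki}\hat\theta_{ki}-\sum_{j:ij\in\mathcal E}B_{ij}\hat\theta_{ij}$: $\dot\eta_i=\mathbf{prox}_{f_{i,2}}(d_i-\kappa\eta_i)-d_i$; $\dot d_i=\mathbf{prox}_{f_{i,1}}\big(d_i-\nabla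 f_{i,0}(d_i)+\kappa\eta_i+\lambda_i+u_{i,1}+\mu_i+u_{i,2}\big)-d_i$; $\omega_i=\lambda_i$; $\dot{\hat\theta}_i=\sum_{j:ij\in\mathcal E}B_{ij}(\mu_i+u_{i,2}-\mu_j-u_{j,2})-\sum_{k:ki\in\mathcal E}B_{ki}(\mu_k+u_{k,2}-\mu_i-u_{i,2})$; $\dot P_{ij}=\lambda_i+u_{i,1}-\lambda_j-u_{j,1}$; $\dot\lambda_i=\tfrac12u_{i,1}$; $\dot\mu_i=\tfrac12u_{i,2}$. An equilibrium point is a point at which all these right-hand sides vanish. *)

theory Defs
  imports "HOL-Analysis.Analysis" "HOL-Library.Extended_Real"
begin

text \<open>Buses are the elements of a finite type 'n; lines are a set E of ordered pairs.\<close>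

definition weakly_connected :: "('n \<times> 'n) set \<Rightarrow> bool" where
  "weakly_connected E \<longleftrightarrow> (\<forall>i j. (i, j) \<in> (E \<union> E\<inverse>)\<^sup>*)"

text \<open>beta-strong convexity of a real function: f - beta/2 x^2 is convex.\<close>
definition strongly_convex :: "real \<Rightarrow> (real \<Rightarrow> real) \<Rightarrow> bool" where
  "strongly_convex \<beta> f \<longleftrightarrow> convex_on UNIV (\<lambda>x. f x - \<beta> / 2 * x\<^sup>2)"

definition lsc :: "(real \<Rightarrow> real) \<Rightarrow> bool" where
  "lsc f \<longleftrightarrow> (\<forall>x. \<forall>a < f x. eventually (\<lambda>y. a < f y) (at x))"

text \<open>Indicator function of the interval [lo, hi] (extended-real valued).\<close>
definition ind_interval :: "real \<Rightarrow> real \<Rightarrow> real \<Rightarrow> ereal" where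
  "ind_interval lo hi x = (if x \<in> {lo..hi} then 0 else \<infinity>)"

text \<open>Proximal operator prox_g(y) = argmin_x g(x) + 1/2 |x - y|^2.\<close>
definition prox :: "(real \<Rightarrow> ereal) \<Rightarrow> real \<Rightarrow> real" where
  "prox g y = (SOME x. \<forall>z. g x + ereal ((x - y)\<^sup>2 / 2) \<le> g z + ereal ((z - y)\<^sup>2 / 2))"

text \<open>Network flow terms: sum over incoming lines minus sum over outgoing lines.\<close>
definition line_net :: "('n \<times> 'n) set \<Rightarrow> ('n \<times> 'n \<Rightarrow> real) \<Rightarrow> 'n \<Rightarrow> real" where
  "line_net E F i = (\<Sum>k\<in>{k. (k, i) \<in> E}. F (k, i)) - (\<Sum>j\<in>{j. (i, j) \<in> E}. F (i, j))"

definition u1 :: "('n \<times> 'n) set \<Rightarrow> ('n \<Rightarrow> real) \<Rightarrow> ('n \<Rightarrow> real) \<Rightarrow>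
    real^'n \<Rightarrow> real^'n \<Rightarrow> ('n \<times> 'n \<Rightarrow> real) \<Rightarrow> 'n \<Rightarrow> real" where
  "u1 E D Pin d \<omega> P i = Pin i - d$i - D i * \<omega>$i + line_net E P i"

definition u2 :: "('n \<times> 'n) set \<Rightarrow> ('n \<times> 'n \<Rightarrow> real) \<Rightarrow> ('n \<Rightarrow> real) \<Rightarrow>
    real^'n \<Rightarrow> real^'n \<Rightarrow> 'n \<Rightarrow> real" where
  "u2 E B Pin d \<theta> i = Pin i - d$i + line_net E (\<lambda>(a, b). B (a, b) * (\<theta>$a - \<theta>$b)) i"

text \<open>Right-hand sides of the DPPD dynamics (without line limits), with omega = lambda.\<close>
definition rhs_eta where
  "rhs_eta f2 \<kappa> \<eta> d i = prox (\<lambda>x. ereal (f2 i x)) (d$i - \<kappa> * \<eta>$i) - d$i"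

definition rhs_d where
  "rhs_d E B D Pin f0 dlo dhi \<kappa> \<eta> d \<theta> P lam \<mu> i =
     prox (ind_interval (dlo i) (dhi i))
       (d$i - deriv (f0 i) (d$i) + \<kappa> * \<eta>$i + lam$i + u1 E D Pin d lam P i
        + \<mu>$i + u2 E B Pin d \<theta> i) - d$i"

definition rhs_theta where
  "rhs_theta E B Pin d \<theta> \<mu> i =
     (\<Sum>j\<in>{j. (i, j) \<in> E}. B (i, j) * (\<mu>$i + u2 E B Pin d \<theta> i - \<mu>$j - u2 E B Pin d \<theta> j))
   - (\<Sum>k\<in>{k. (k, i) \<in> E}. B (k, i) * (\<mu>$k + u2 E B Pin d \<theta> k - \<mu>$i - u2 E B Pin d \<theta> i))"

definition rhs_P where
  "rhs_P E D Pin d P lam ij =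
     lam$(fst ij) + u1 E D Pin d lam P (fst ij) - lam$(snd ij) - u1 E D Pin d lam P (snd ij)"

definition rhs_lambda where
  "rhs_lambda E D Pin d P lam i = u1 E D Pin d lam P i / 2"

definition rhs_mu where
  "rhs_mu E B Pin d \<theta> i = u2 E B Pin d \<theta> i / 2"

text \<open>A trajectory of the DPPD dynamics on [0,\<infinity>) (with omega(t) = lambda(t)).\<close>
definition dppd_trajectory where
  "dppd_trajectory E B D Pin f0 f2 dlo dhi \<kappa> \<eta> d \<theta> P \<omega> \<mu> \<longleftrightarrow>
    (\<forall>t\<ge>0. \<forall>i.
       ((\<lambda>s. \<eta> s $ i) has_real_derivative rhs_eta f2 \<kappa> (\<eta> t) (d t) i) (at t within {0..}) \<and>
       ((\<lambda>s. d s $ i) has_real_derivative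
          rhs_d E B D Pin f0 dlo dhi \<kappa> (\<eta> t) (d t) (\<theta> t) (P t) (\<omega> t) (\<mu> t) i) (at t within {0..}) \<and>
       ((\<lambda>s. \<theta> s $ i) has_real_derivative rhs_theta E B Pin (d t) (\<theta> t) (\<mu> t) i) (at t within {0..}) \<and>
       ((\<lambda>s. \<omega> s $ i) has_real_derivative rhs_lambda E D Pin (d t) (P t) (\<omega> t) i) (at t within {0..}) \<and>
       ((\<lambda>s. \<mu> s $ i) has_real_derivative rhs_mu E B Pin (d t) (\<theta> t) i) (at t within {0..})) \<and>
    (\<forall>t\<ge>0. \<forall>ij\<in>E.
       ((\<lambda>s. P s ij) has_real_derivative rhs_P E D Pin (d t) (P t) (\<omega> t) ij) (at t within {0..}))"

definition dppd_equilibrium where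
  "dppd_equilibrium E B D Pin f0 f2 dlo dhi \<kappa> \<eta> d \<theta> P \<omega> \<mu> \<longleftrightarrow>
    (\<forall>i. rhs_eta f2 \<kappa> \<eta> d i = 0 \<and>
         rhs_d E B D Pin f0 dlo dhi \<kappa> \<eta> d \<theta> P \<omega> \<mu> i = 0 \<and>
         rhs_theta E B Pin d \<theta> \<mu> i = 0 \<and>
         rhs_lambda E D Pin d P \<omega> i = 0 \<and>
         rhs_mu E B Pin d \<theta> i = 0) \<and>
    (\<forall>ij\<in>E. rhs_P E D Pin d P \<omega> ij = 0)"

text \<open>ROLC problem without line limits.\<close>
definition rolc_feasible where
  "rolc_feasible E B D Pin d \<theta> \<omega> P \<longleftrightarrow>
    (\<forall>i. 0 = Pin i - D i * \<omega>$i - d$i + line_net E P i \<and> u2 E B Pin d \<theta> i = 0)"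

definition rolc_objective :: "('n::finite \<Rightarrow> real) \<Rightarrow> ('n \<Rightarrow> real \<Rightarrow> real) \<Rightarrow> ('n \<Rightarrow> real \<Rightarrow> real)
    \<Rightarrow> ('n \<Rightarrow> real) \<Rightarrow> ('n \<Rightarrow> real) \<Rightarrow> real^'n \<Rightarrow> real^'n \<Rightarrow> ereal" where
  "rolc_objective D f0 f2 dlo dhi d \<omega> =
    (\<Sum>i\<in>UNIV. ereal (f0 i (d$i)) + ind_interval (dlo i) (dhi i) (d$i) + ereal (f2 i (d$i))
               + ereal (D i / 2 * (\<omega>$i)\<^sup>2))"

definition rolc_optimal where
  "rolc_optimal E B D Pin f0 f2 dlo dhi d \<theta> P \<omega> \<longleftrightarrow>
    rolc_feasible E B D Pin d \<theta> \<omega> P \<and>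
    (\<forall>d' \<theta>' P' \<omega>'. rolc_feasible E B D Pin d' \<theta>' \<omega>' P' \<longrightarrow>
        rolc_objective D f0 f2 dlo dhi d \<omega> \<le> rolc_objective D f0 f2 dlo dhi d' \<omega>')"

end

theory Submission
  imports Defs
begin

text \<open>
  At an equilibrium \<open>\<omega> = 0\<close> and \<open>\<mu>\<close> is a constant \<open>c\<close>; the pair \<open>(d, c)\<close> solves the resource
  allocation problem of minimising the total cost subject to \<open>\<Sum>d = \<Sum>Pin\<close>. A suitable \<open>c\<close> exists by the
  intermediate value theorem, and \<open>\<theta>\<close> because the range of a connected Laplacian consists of the
  vectors with zero sum.

  Relative to an equilibrium, with \<open>e, x, h, l, m\<close> the deviations of \<open>\<eta>, d, \<theta>, \<omega>, \<mu>\<close> at a node,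
  \<open>a, b\<close> the residuals \<open>u1, u2\<close> and \<open>r\<close> the Bregman distance of \<open>f0\<close>, the function
  \<open>\<Sum> (\<kappa>/2 e\<^sup>2 + x\<^sup>2/2 - \<kappa>ex + r + h\<^sup>2/2 + (1 + 3D/2) l\<^sup>2 + m\<^sup>2 + a\<^sup>2/2 + la + b\<^sup>2/2 + mb)\<close>
  plus half the squared deviation of \<open>P\<close> is coercive and decreases at a rate that dominates the squared
  norm of the vector field. Hence trajectories are bounded and have a limit point at which the
  vector field vanishes. Taking this limit point as the reference equilibrium,
  the Lyapunov function tends to \<open>0\<close> along a sequence of times, so by monotonicity it tends to \<open>0\<close>.
\<close>

subsection \<open>Proximal operators and convex functions on the line\<close>

definition subgrad :: "(real \<Rightarrow> real) \<Rightarrow> real \<Rightarrow> real \<Rightarrow> bool" where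
  "subgrad f x g \<longleftrightarrow> (\<forall>z. f z \<ge> f x + g * (z - x))"

lemma subgrad_mono:
  assumes "subgrad f x g" "subgrad f y h"
  shows "(g - h) * (x - y) \<ge> 0"
proof -
  have "f y \<ge> f x + g * (y - x)" "f x \<ge> f y + h * (x - y)"
    using assms unfolding subgrad_def by blast+
  then show ?thesis by (simp add: algebra_simps)
qed

lemma subgrad_exists:
  assumes "convex_on UNIV f"
  shows "\<exists>g. subgrad f x g"
  using convex_le_Inf_differential[OF assms, of x] unfolding subgrad_def by auto

lemma convex_imp_continuous_real:
  fixes f :: "real \<Rightarrow> real"
  assumes "convex_on UNIV f"
  shows "continuous_on S f"
  using convex_on_continuous[OF open_UNIV assms] continuous_on_subset by blast

text \<open>First-order optimality for a smooth part \<open>h\<close> plus a convex part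
  \<open>f\<close>. Along the segment towards \<open>z\<close>, \<open>f\<close> grows at most like
  its chord and \<open>h\<close> like \<open>D * (z - x)\<close>; if the claim failed, a short move
  would lower \<open>h + f\<close>.\<close>

lemma composite_minimizer_variational:
  fixes f h :: "real \<Rightarrow> real"
  assumes S: "convex S" "x \<in> S" "z \<in> S"
    and h: "(h has_real_derivative D) (at x)"
    and f: "convex_on S f"
    and min: "\<And>z. z \<in> S \<Longrightarrow> h x + f x \<le> h z + f z"
  shows "f z \<ge> f x - D * (z - x)"
proof (rule ccontr)
  assume neg: "\<not> ?thesis"
  \<comment> \<open>Up to the constant \<open>f x\<close>, this majorizes \<open>h + f\<close> along
    the segment, with equality at \<open>t = 0\<close>.\<close>
  define \<phi> where "\<phi> t = h (x + t * (z - x)) + t * (f z - f x)" for t :: real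
  have h': "(h has_real_derivative D) (at (x + 0 * (z - x)))" using h by simp
  have "(\<phi> has_real_derivative D * (z - x) + (f z - f x)) (at 0)"
    unfolding \<phi>_def by (rule derivative_eq_intros DERIV_chain2[where f = h and g = "\<lambda>t. x + t * (z - x)", OF h'] refl | simp)+
  moreover have "D * (z - x) + (f z - f x) < 0" using neg by simp
  ultimately obtain \<delta> where \<delta>: "\<delta> > 0" "\<And>t. t > 0 \<Longrightarrow> t < \<delta> \<Longrightarrow> \<phi> 0 > \<phi> (0 + t)"
    using DERIV_neg_dec_right by blast
  define t where "t = min (\<delta> / 2) 1"
  have t: "0 < t" "t < \<delta>" "t \<le> 1" using \<delta>(1) by (auto simp: t_def)
  have eq: "(1 - t) *\<^sub>R x + t *\<^sub>R z = x + t * (z - x)" by (simp add: algebra_simps)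
  have inS: "x + t * (z - x) \<in> S"
    using convexD_alt[OF S(1) S(2) S(3), of t] t eq by simp
  have "f (x + t * (z - x)) \<le> (1 - t) * f x + t * f z"
    using convex_onD[OF f, of t x z] t S eq by simp
  then have "h x + f x \<le> h (x + t * (z - x)) + ((1 - t) * f x + t * f z)"
    using min[OF inS] by linarith
  then have "\<phi> 0 \<le> \<phi> t" unfolding \<phi>_def by (simp add: algebra_simps)
  then show False using \<delta>(2)[of t] t by simp
qed

text \<open>\<open>prox\<close> is a choice operator, so its value carries information only after
  some minimizer has been exhibited.\<close>

lemma prox_minimizer:
  assumes "\<exists>x. \<forall>z. g x + ereal ((x - y)\<^sup>2 / 2) \<le> g z + ereal ((z - y)\<^sup>2 / 2)"
  shows "g (prox g y) + ereal ((prox g y - y)\<^sup>2 / 2) \<le> g z + ereal ((z - y)\<^sup>2 / 2)"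
  using someI_ex[OF assms] unfolding prox_def by blast

text \<open>Existence: a subgradient \<open>s\<close> at \<open>y\<close> costs at most
  \<open>\<bar>s\<bar> * \<bar>z - y\<bar>\<close>, which the quadratic term outweighs beyond radius
  \<open>2 * \<bar>s\<bar>\<close>; hence a minimizer on that compact ball is global. The
  subgradient is then the first-order condition for the quadratic term.\<close>

lemma prox_convex_subgrad:
  assumes f: "convex_on UNIV f"
  shows "subgrad f (prox (\<lambda>x. ereal (f x)) y) (y - prox (\<lambda>x. ereal (f x)) y)"
proof -
  obtain s where s: "subgrad f y s" using subgrad_exists[OF f] by blast
  let ?G = "\<lambda>x. f x + (x - y)\<^sup>2 / 2"
  have "continuous_on (cball y (2 * \<bar>s\<bar>)) ?G"
    by (intro continuous_intros convex_imp_continuous_real[OF f]) simp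
  then obtain x where x: "x \<in> cball y (2 * \<bar>s\<bar>)" "\<And>z. z \<in> cball y (2 * \<bar>s\<bar>) \<Longrightarrow> ?G x \<le> ?G z"
    using continuous_attains_inf[OF compact_cball, of y "2 * \<bar>s\<bar>" ?G] by (auto simp: not_le)
  have min: "?G x \<le> ?G z" for z
  proof (cases "z \<in> cball y (2 * \<bar>s\<bar>)")
    case False
    then have far: "2 * \<bar>s\<bar> \<le> \<bar>z - y\<bar>" by (simp add: dist_real_def abs_minus_commute)
    have "- (s * (z - y)) \<le> \<bar>s\<bar> * \<bar>z - y\<bar>"
      by (metis abs_ge_minus_self abs_mult)
    also have "\<dots> \<le> \<bar>z - y\<bar> / 2 * \<bar>z - y\<bar>"
      using far by (intro mult_right_mono) auto
    also have "\<dots> = (z - y)\<^sup>2 / 2" by (simp add: power2_eq_square flip: abs_mult)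
    finally have "f y \<le> ?G z" using s[unfolded subgrad_def, rule_format, of z] by linarith
    moreover have "?G x \<le> ?G y" by (rule x(2)) simp
    ultimately show ?thesis by simp
  qed (use x in blast)
  have ex: "\<exists>x. \<forall>z. ereal (f x) + ereal ((x - y)\<^sup>2 / 2) \<le> ereal (f z) + ereal ((z - y)\<^sup>2 / 2)"
    using min by auto
  define p where "p = prox (\<lambda>x. ereal (f x)) y"
  have pmin: "(p - y)\<^sup>2 / 2 + f p \<le> (z - y)\<^sup>2 / 2 + f z" for z
    using prox_minimizer[OF ex, of z] unfolding p_def by (simp add: add.commute)
  have "((\<lambda>x. (x - y)\<^sup>2 / 2) has_real_derivative (p - y)) (at p)"
    by (auto intro!: derivative_eq_intros)
  then have "f z \<ge> f p - (p - y) * (z - p)" for z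
    using composite_minimizer_variational[OF convex_UNIV UNIV_I UNIV_I _ f, of "\<lambda>x. (x - y)\<^sup>2 / 2"] pmin
    by blast
  then show ?thesis unfolding subgrad_def p_def by (simp add: algebra_simps)
qed

text \<open>Both \<open>x\<close> and the proximal point solve the same subgradient inclusion, and
  monotonicity of subgradients makes its solution unique.\<close>

lemma prox_convex_eqI:
  assumes "convex_on UNIV f" "subgrad f x (y - x)"
  shows "prox (\<lambda>x. ereal (f x)) y = x"
proof -
  define p where "p = prox (\<lambda>x. ereal (f x)) y"
  have "(y - p - (y - x)) * (p - x) \<ge> 0"
    using subgrad_mono[OF prox_convex_subgrad[OF assms(1)] assms(2)] unfolding p_def .
  then have "(p - x)\<^sup>2 \<le> 0" by (simp add: algebra_simps power2_eq_square)
  then show ?thesis unfolding p_def by simp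
qed

text \<open>Monotonicity of the subgradients \<open>y - p\<close> and \<open>z - q\<close> bounds
  \<open>(p - q)^2\<close> by \<open>(y - z) * (p - q)\<close>. The purpose is continuity of the
  right-hand side for \<open>\<eta>\<close>.\<close>

lemma prox_convex_nonexpansive:
  assumes "convex_on UNIV f"
  shows "\<bar>prox (\<lambda>x. ereal (f x)) y - prox (\<lambda>x. ereal (f x)) z\<bar> \<le> \<bar>y - z\<bar>"
proof -
  define p q where "p = prox (\<lambda>x. ereal (f x)) y" and "q = prox (\<lambda>x. ereal (f x)) z"
  have "(y - p - (z - q)) * (p - q) \<ge> 0"
    using subgrad_mono[OF prox_convex_subgrad[OF assms] prox_convex_subgrad[OF assms]]
    unfolding p_def q_def .
  then have "(p - q)\<^sup>2 \<le> (y - z) * (p - q)" by (simp add: algebra_simps power2_eq_square)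
  also have "\<dots> \<le> \<bar>y - z\<bar> * \<bar>p - q\<bar>" by (metis abs_ge_self abs_mult)
  finally have "\<bar>p - q\<bar> * \<bar>p - q\<bar> \<le> \<bar>y - z\<bar> * \<bar>p - q\<bar>"
    by (simp add: power2_eq_square flip: abs_mult)
  then have "\<bar>p - q\<bar> \<le> \<bar>y - z\<bar>"
    by (metis abs_ge_zero mult_right_le_imp_le order_le_less)
  then show ?thesis unfolding p_def q_def .
qed

lemma isCont_prox_convex:
  assumes "convex_on UNIV f"
  shows "isCont (prox (\<lambda>x. ereal (f x))) y"
  unfolding isCont_def LIM_def
  using prox_convex_nonexpansive[OF assms] by (metis dist_real_def le_less_trans)

text \<open>The clamped point satisfies the obtuse-angle inequality \<open>cz\<close>, hence the
  quadratic growth \<open>cmin\<close>, which yields minimality and also forces every minimizer to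
  coincide with it.\<close>

lemma prox_ind_interval:
  assumes "lo \<le> hi"
  shows "prox (ind_interval lo hi) y = max lo (min hi y)"
proof -
  define c where "c = max lo (min hi y)"
  have c: "c \<in> {lo..hi}" using assms by (auto simp: c_def)
  have cz: "(y - c) * (z - c) \<le> 0" if "z \<in> {lo..hi}" for z
    using that by (auto simp: c_def max_def min_def mult_le_0_iff)
  have cmin: "(c - y)\<^sup>2 / 2 + (z - c)\<^sup>2 / 2 \<le> (z - y)\<^sup>2 / 2" if "z \<in> {lo..hi}" for z
  proof -
    have "(z - y)\<^sup>2 / 2 - (c - y)\<^sup>2 / 2 - (z - c)\<^sup>2 / 2 = - ((y - c) * (z - c))"
      by (simp add: power2_eq_square field_simps)
    then show ?thesis using cz[OF that] by linarith
  qed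
  have "ind_interval lo hi c + ereal ((c - y)\<^sup>2 / 2) \<le> ind_interval lo hi z + ereal ((z - y)\<^sup>2 / 2)" for z
  proof (cases "z \<in> {lo..hi}")
    case True
    then have "(c - y)\<^sup>2 / 2 \<le> (z - y)\<^sup>2 / 2" using cmin[OF True] zero_le_power2[of "z - c"] by linarith
    then show ?thesis using True c by (simp add: ind_interval_def)
  next
    case False then show ?thesis unfolding ind_interval_def by (simp only: if_False) simp
  qed
  then have ex: "\<exists>x. \<forall>z. ind_interval lo hi x + ereal ((x - y)\<^sup>2 / 2) \<le> ind_interval lo hi z + ereal ((z - y)\<^sup>2 / 2)"
    by blast
  define p where "p = prox (ind_interval lo hi) y"
  have pc: "ind_interval lo hi p + ereal ((p - y)\<^sup>2 / 2) \<le> ereal ((c - y)\<^sup>2 / 2)"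
  proof -
    have "ind_interval lo hi c = 0" using c by (simp add: ind_interval_def)
    then show ?thesis using prox_minimizer[OF ex, of c] unfolding p_def by simp
  qed
  then have p: "p \<in> {lo..hi}" unfolding ind_interval_def by (cases "p \<in> {lo..hi}") auto
  then have "(p - y)\<^sup>2 / 2 \<le> (c - y)\<^sup>2 / 2" using pc by (simp add: ind_interval_def)
  then have "(p - c)\<^sup>2 \<le> 0" using cmin[OF p] by linarith
  then show ?thesis unfolding p_def c_def by simp
qed

lemma clamp_variational:
  fixes lo hi y z :: real
  assumes "lo \<le> z" "z \<le> hi"
  shows "(y - max lo (min hi y)) * (max lo (min hi y) - z) \<ge> 0"
  using assms by (auto simp: max_def min_def zero_le_mult_iff)

text \<open>The right-hand side puts \<open>s\<close> in the normal cone of the interval at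
  \<open>x\<close>. Testing it at the two endpoints already determines the sign of
  \<open>s\<close>.\<close>

lemma clamp_fixed_iff:
  fixes lo hi x s :: real
  assumes "lo \<le> hi"
  shows "max lo (min hi (x + s)) = x \<longleftrightarrow> lo \<le> x \<and> x \<le> hi \<and> (\<forall>z\<in>{lo..hi}. s * (z - x) \<le> 0)"
proof
  assume L: "max lo (min hi (x + s)) = x"
  then have "lo \<le> x" "x \<le> hi" using assms by auto
  moreover have "s * (z - x) \<le> 0" if "z \<in> {lo..hi}" for z
    using clamp_variational[of lo z hi "x + s"] that L
    by (auto simp: algebra_simps)
  ultimately show "lo \<le> x \<and> x \<le> hi \<and> (\<forall>z\<in>{lo..hi}. s * (z - x) \<le> 0)" by blast
next
  assume R: "lo \<le> x \<and> x \<le> hi \<and> (\<forall>z\<in>{lo..hi}. s * (z - x) \<le> 0)"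
  then have "s * (hi - x) \<le> 0" "s * (lo - x) \<le> 0" using assms by auto
  then have "s \<le> 0 \<or> x = hi" "s \<ge> 0 \<or> x = lo" using R by (auto simp: mult_le_0_iff)
  then show "max lo (min hi (x + s)) = x" using R by auto
qed

section \<open>Tangents and derivatives of strongly convex functions\<close>

lemma strongly_convex_tangent:
  assumes "strongly_convex \<beta> f" "f differentiable (at x)"
  shows "f y \<ge> f x + deriv f x * (y - x) + \<beta> / 2 * (y - x)\<^sup>2"
proof -
  have "(f has_real_derivative deriv f x) (at x)"
    using assms(2) by (simp add: DERIV_deriv_iff_real_differentiable)
  then have "((\<lambda>x. f x - \<beta> / 2 * x\<^sup>2) has_real_derivative (deriv f x - \<beta> * x)) (at x within UNIV)"
    by (auto intro!: derivative_eq_intros)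
  from convex_on_imp_above_tangent[OF _ _ _ _ this, of y] assms(1)
  have "(f y - \<beta> / 2 * y\<^sup>2) - (f x - \<beta> / 2 * x\<^sup>2) \<ge> (deriv f x - \<beta> * x) * (y - x)"
    unfolding strongly_convex_def by auto
  then show ?thesis by (simp add: power2_eq_square field_simps)
qed

lemma strongly_convex_deriv_mono:
  assumes "strongly_convex \<beta> f" "f differentiable (at x)" "f differentiable (at y)"
  shows "(deriv f x - deriv f y) * (x - y) \<ge> \<beta> * (x - y)\<^sup>2"
  using strongly_convex_tangent[OF assms(1,2), of y] strongly_convex_tangent[OF assms(1,3), of x]
  by (simp add: power2_eq_square field_simps)

text \<open>The cost \<open>f0\<close> is only assumed differentiable, while passing to limits in
  the vector field needs a continuous derivative. By convexity a difference quotient of fixed step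
  bounds the derivative on one side, and it is continuous in the base point; the step is chosen so
  that at \<open>x\<close> the quotient already lies on the right side of \<open>a\<close>.\<close>

lemma strongly_convex_isCont_deriv:
  assumes sc: "strongly_convex \<beta> f" "\<beta> \<ge> 0" and diff: "\<And>x. f differentiable (at x)"
  shows "isCont (deriv f) x"
proof -
  have Df: "(f has_real_derivative deriv f x) (at x)" for x
    using diff by (simp add: DERIV_deriv_iff_real_differentiable)
  have tang: "deriv f y * h \<le> f (y + h) - f y" for y h
    using strongly_convex_tangent[OF sc(1) diff, of y "y + h"]
      mult_nonneg_nonneg[OF sc(2) zero_le_power2[of h]] by simp
  have lim: "((\<lambda>y. f (y + h) - f y) \<longlongrightarrow> f (x + h) - f x) (at x)" for h
  proof -
    have "isCont (\<lambda>y. f (y + h)) x"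
      by (rule isCont_o2[where f = "\<lambda>y. y + h"]) (auto intro: DERIV_isCont[OF Df])
    then show ?thesis using DERIV_isCont[OF Df, of x] unfolding isCont_def by (intro tendsto_diff)
  qed
  have "(deriv f \<longlongrightarrow> deriv f x) (at x)"
  proof (rule order_tendstoI)
    fix a assume a: "a < deriv f x"
    have "((\<lambda>h. f h - a * h) has_real_derivative deriv f x - a) (at x)"
      by (auto intro!: derivative_eq_intros Df)
    then obtain \<delta> where \<delta>: "\<delta> > 0" "\<And>h. h > 0 \<Longrightarrow> h < \<delta> \<Longrightarrow> f (x - h) - a * (x - h) < f x - a * x"
      using has_real_derivative_pos_inc_left[of "\<lambda>h. f h - a * h" "deriv f x - a" x UNIV] a by auto
    define h where "h = \<delta> / 2"
    have h: "h > 0" "f (x + (- h)) - f x < - a * h"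
      using \<delta>(1) \<delta>(2)[of h] by (auto simp: algebra_simps h_def)
    have "eventually (\<lambda>y. f (y + (- h)) - f y < - a * h) (at x)"
      using order_tendstoD(2)[OF lim h(2)] .
    then show "eventually (\<lambda>y. a < deriv f y) (at x)"
    proof eventually_elim
      case (elim y)
      have "deriv f y * (- h) < - a * h" using tang[of y "- h"] elim by linarith
      then show ?case using h(1) by simp
    qed
  next
    fix a assume a: "a > deriv f x"
    have "((\<lambda>h. f h - a * h) has_real_derivative deriv f x - a) (at x)"
      by (auto intro!: derivative_eq_intros Df)
    then obtain \<delta> where \<delta>: "\<delta> > 0" "\<And>h. h > 0 \<Longrightarrow> h < \<delta> \<Longrightarrow> f (x + h) - a * (x + h) < f x - a * x"
      using DERIV_neg_dec_right[of "\<lambda>h. f h - a * h" "deriv f x - a" x] a by auto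
    have h: "\<delta> / 2 > 0" "f (x + \<delta> / 2) - f x < a * (\<delta> / 2)"
      using \<delta>(1) \<delta>(2)[of "\<delta> / 2"] by (auto simp: algebra_simps)
    have "eventually (\<lambda>y. f (y + \<delta> / 2) - f y < a * (\<delta> / 2)) (at x)"
      using order_tendstoD(2)[OF lim h(2)] .
    then show "eventually (\<lambda>y. deriv f y < a) (at x)"
    proof eventually_elim
      case (elim y)
      have "deriv f y * (\<delta> / 2) < a * (\<delta> / 2)" using tang[of y "\<delta> / 2"] elim by linarith
      then show ?case using h(1) by simp
    qed
  qed
  then show ?thesis unfolding isCont_def .
qed

text \<open>Here \<open>z\<close> lies between \<open>x\<close> and \<open>w\<close>, so the chord
  from \<open>x\<close> to \<open>w\<close> passes above \<open>f z\<close>; an affine lower bound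
  touching at \<open>x\<close> and valid at \<open>z\<close> therefore persists at
  \<open>w\<close>.\<close>

lemma convex_on_le_affine_extend:
  fixes f :: "real \<Rightarrow> real"
  assumes f: "convex_on UNIV f" and z: "f z \<ge> f x + s * (z - x)" and zw: "(z - x) * (w - x) > 0"
    and far: "\<bar>w - x\<bar> \<ge> \<bar>z - x\<bar>"
  shows "f w \<ge> f x + s * (w - x)"
proof -
  define t where "t = (z - x) / (w - x)"
  have ne: "w \<noteq> x" "z \<noteq> x" using zw by auto
  have t: "t > 0" "t \<le> 1"
  proof -
    show "t > 0" using zw unfolding t_def by (simp add: zero_less_divide_iff zero_less_mult_iff)
    have "\<bar>t\<bar> \<le> 1" using far ne unfolding t_def by (simp add: abs_divide divide_le_eq_1)
    then show "t \<le> 1" by simp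
  qed
  have tw: "z - x = t * (w - x)" unfolding t_def using ne by simp
  then have z_eq: "(1 - t) *\<^sub>R x + t *\<^sub>R w = z" by (simp add: algebra_simps)
  have "f z \<le> (1 - t) * f x + t * f w" using convex_onD[OF f, of t x w] t z_eq by simp
  then have "f x + s * (t * (w - x)) \<le> (1 - t) * f x + t * f w"
    using z unfolding tw by linarith
  then have "t * (f x + s * (w - x)) \<le> t * f w"
    by (simp add: algebra_simps)
  then show ?thesis using t by simp
qed

subsection \<open>Resource allocation with a common price\<close>

text \<open>The KKT condition for minimizing \<open>f0 x + f2 x - c * x\<close> over the interval,
  with \<open>c\<close> the price. The subgradient \<open>g\<close> is kept apart from the normal
  vector because it determines \<open>\<eta>\<close> at an equilibrium.\<close>

definition stationary :: "(real \<Rightarrow> real) \<Rightarrow> (real \<Rightarrow> real) \<Rightarrow> real \<Rightarrow> real \<Rightarrow> real \<Rightarrow> real \<Rightarrow> bool" where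
  "stationary f0 f2 lo hi c x \<longleftrightarrow> lo \<le> x \<and> x \<le> hi \<and>
    (\<exists>g. subgrad f2 x g \<and> (\<forall>z\<in>{lo..hi}. (c - deriv f0 x - g) * (z - x) \<le> 0))"

text \<open>A minimizer over the compact interval is stationary. Minimality only gives a slope
  \<open>s\<close> supporting \<open>f2\<close> on the interval; the work lies in splitting
  \<open>s\<close> into a subgradient valid on the whole line and a normal vector.\<close>

lemma stationary_exists:
  fixes f0 f2 :: "real \<Rightarrow> real"
  assumes lohi: "lo \<le> hi" and f0: "\<And>x. f0 differentiable (at x)" and f2: "convex_on UNIV f2"
  shows "\<exists>x. stationary f0 f2 lo hi c x"
proof -
  have Df0: "(f0 has_real_derivative deriv f0 x) (at x)" for x
    using f0 by (simp add: DERIV_deriv_iff_real_differentiable)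
  have "continuous_on {lo..hi} (\<lambda>x. (f0 x - c * x) + f2 x)"
    by (intro continuous_intros convex_imp_continuous_real[OF f2]
        DERIV_continuous_on[OF has_field_derivative_at_within[OF Df0]])
  then obtain x where x: "x \<in> {lo..hi}"
    and min: "\<And>z. z \<in> {lo..hi} \<Longrightarrow> (f0 x - c * x) + f2 x \<le> (f0 z - c * z) + f2 z"
    using continuous_attains_inf[of "{lo..hi}" "\<lambda>x. (f0 x - c * x) + f2 x"] lohi by auto
  define s where "s = c - deriv f0 x"
  have "((\<lambda>x. f0 x - c * x) has_real_derivative - s) (at x)"
    unfolding s_def by (auto intro!: derivative_eq_intros Df0)
  moreover have "convex_on {lo..hi} f2" using f2 convex_on_subset by blast
  ultimately have s: "f2 z \<ge> f2 x + s * (z - x)" if "z \<in> {lo..hi}" for z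
    using composite_minimizer_variational[of "{lo..hi}" x z "\<lambda>x. f0 x - c * x" "- s" f2] that x min
    by auto
  obtain g where g: "subgrad f2 x g" using subgrad_exists[OF f2] by blast
  \<comment> \<open>Either \<open>s\<close> itself is a subgradient, or any subgradient \<open>g\<close> differs from \<open>s\<close> by a normal vector.\<close>
  have "subgrad f2 x s" if neg: "z \<in> {lo..hi}" "(s - g) * (z - x) > 0" for z
    unfolding subgrad_def
  proof
    fix w
    \<comment> \<open>On the side away from \<open>z\<close>, the inequality for \<open>g\<close> is
      the stronger one. On the side of \<open>z\<close>, either \<open>w\<close> is beyond
      \<open>z\<close> and convexity extends the bound, or \<open>w\<close> is between
      \<open>x\<close> and \<open>z\<close> and hence in the interval.\<close>
    consider "(s - g) * (w - x) \<le> 0" | "(s - g) * (w - x) > 0" by linarith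
    then show "f2 w \<ge> f2 x + s * (w - x)"
    proof cases
      case 1
      then show ?thesis using g[unfolded subgrad_def, rule_format, of w] by (simp add: algebra_simps)
    next
      case 2
      then have same: "(z - x) * (w - x) > 0" using neg(2) by (auto simp: zero_less_mult_iff)
      show ?thesis
      proof (cases "\<bar>w - x\<bar> \<ge> \<bar>z - x\<bar>")
        case True
        then show ?thesis using convex_on_le_affine_extend[OF f2 s[OF neg(1)] same] by blast
      next
        case False
        then have "w \<in> {lo..hi}" using same neg(1) x by (auto simp: zero_less_mult_iff)
        then show ?thesis by (rule s)
      qed
    qed
  qed
  then obtain g' where "subgrad f2 x g'" "\<forall>z\<in>{lo..hi}. (s - g') * (z - x) \<le> 0"
    using g by (metis diff_self mult_zero_left not_less order_refl)
  then show ?thesis using x unfolding stationary_def s_def by auto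
qed

text \<open>Each normal-cone inequality is tested at the other point; their sum, monotonicity of the
  subgradients of \<open>f2\<close> and strong monotonicity of \<open>deriv f0\<close> give the
  bound. It makes the response to a price unique and Lipschitz.\<close>

lemma stationary_strong_monotone:
  assumes "strongly_convex \<beta> f0" "\<And>x. f0 differentiable (at x)"
    and x: "stationary f0 f2 lo hi c x" and y: "stationary f0 f2 lo hi c' y"
  shows "\<beta> * (x - y)\<^sup>2 \<le> (c - c') * (x - y)"
proof -
  obtain g where g: "subgrad f2 x g" "\<forall>z\<in>{lo..hi}. (c - deriv f0 x - g) * (z - x) \<le> 0"
    using x unfolding stationary_def by blast
  obtain g' where g': "subgrad f2 y g'" "\<forall>z\<in>{lo..hi}. (c' - deriv f0 y - g') * (z - y) \<le> 0"
    using y unfolding stationary_def by blast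
  have "(c - deriv f0 x - g) * (y - x) \<le> 0" "(c' - deriv f0 y - g') * (x - y) \<le> 0"
    using g(2) g'(2) x y unfolding stationary_def by auto
  moreover have "(g - g') * (x - y) \<ge> 0" using subgrad_mono[OF g(1) g'(1)] .
  moreover have "(deriv f0 x - deriv f0 y) * (x - y) \<ge> \<beta> * (x - y)\<^sup>2"
    using strongly_convex_deriv_mono assms(1,2) by blast
  ultimately show ?thesis by (simp add: algebra_simps)
qed

lemma stationary_lipschitz:
  assumes "\<beta> > 0" "strongly_convex \<beta> f0" "\<And>x. f0 differentiable (at x)"
    and "stationary f0 f2 lo hi c x" "stationary f0 f2 lo hi c' y"
  shows "\<beta> * \<bar>x - y\<bar> \<le> \<bar>c - c'\<bar>"
proof (cases "x = y")
  case False
  have "\<beta> * \<bar>x - y\<bar> * \<bar>x - y\<bar> = \<beta> * (x - y)\<^sup>2" by (simp add: power2_eq_square flip: abs_mult)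
  also have "\<dots> \<le> (c - c') * (x - y)" using stationary_strong_monotone assms(2-5) by blast
  also have "\<dots> \<le> \<bar>c - c'\<bar> * \<bar>x - y\<bar>" by (metis abs_ge_self abs_mult)
  finally show ?thesis using False by simp
qed simp

text \<open>Once the price exceeds the marginal cost \<open>deriv f0 hi + h\<close>, the residual
  points outwards at \<open>hi\<close> and is normal to the interval; the lower end is
  symmetric.\<close>

lemma stationary_endpoints:
  assumes "lo \<le> hi" "convex_on UNIV f2"
  shows "\<exists>M\<ge>0. (\<forall>c\<ge>M. stationary f0 f2 lo hi c hi) \<and> (\<forall>c\<le>-M. stationary f0 f2 lo hi c lo)"
proof -
  obtain g where g: "subgrad f2 lo g" using subgrad_exists[OF assms(2)] by blast
  obtain h where h: "subgrad f2 hi h" using subgrad_exists[OF assms(2)] by blast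
  define M where "M = \<bar>deriv f0 lo + g\<bar> + \<bar>deriv f0 hi + h\<bar>"
  have "stationary f0 f2 lo hi c hi" if "c \<ge> M" for c
    unfolding stationary_def using assms(1) h that
    by (auto simp: M_def intro!: exI[of _ h] mult_nonneg_nonpos)
  moreover have "stationary f0 f2 lo hi c lo" if "c \<le> - M" for c
    unfolding stationary_def using assms(1) g that
    by (auto simp: M_def intro!: exI[of _ g] mult_nonpos_nonneg)
  moreover have "M \<ge> 0" by (simp add: M_def)
  ultimately show ?thesis by blast
qed

text \<open>Each response \<open>X i c\<close> is a Lipschitz function of the price, so the total
  response is continuous; it runs from the sum of the lower bounds to that of the upper bounds, and
  the intermediate value theorem finds the price.\<close>

lemma stationary_resource_allocation:
  fixes f0 f2 :: "'n::finite \<Rightarrow> real \<Rightarrow> real"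
  assumes \<beta>: "\<beta> > 0" and sc: "\<And>i. strongly_convex \<beta> (f0 i)"
    and diff: "\<And>i x. f0 i differentiable (at x)" and f2: "\<And>i. convex_on UNIV (f2 i)"
    and box: "\<And>i. lo i \<le> hi i" and S: "(\<Sum>i\<in>UNIV. lo i) \<le> S" "S \<le> (\<Sum>i\<in>UNIV. hi i)"
  shows "\<exists>c x. (\<forall>i. stationary (f0 i) (f2 i) (lo i) (hi i) c (x i)) \<and> (\<Sum>i\<in>UNIV. x i) = S"
proof -
  obtain X where X: "\<And>i c. stationary (f0 i) (f2 i) (lo i) (hi i) c (X i c)"
  proof -
    have "\<forall>i c. \<exists>x. stationary (f0 i) (f2 i) (lo i) (hi i) c x"
      using stationary_exists box diff f2 by blast
    then show ?thesis using that by metis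
  qed
  have lip: "\<beta> * \<bar>X i c - X i c'\<bar> \<le> \<bar>c - c'\<bar>" for i c c'
    using stationary_lipschitz[OF \<beta> sc diff X X] .
  have unique: "X i c = y" if "stationary (f0 i) (f2 i) (lo i) (hi i) c y" for i c y
    using stationary_lipschitz[OF \<beta> sc diff X[of i c] that] \<beta> by (simp add: mult_le_0_iff)
  have "isCont (X i) c" for i c
    unfolding isCont_def LIM_def
  proof (intro allI impI)
    fix e :: real assume e: "e > 0"
    have "dist (X i y) (X i c) < e" if "dist y c < \<beta> * e" for y
    proof -
      have "\<beta> * \<bar>X i y - X i c\<bar> < \<beta> * e" using lip[of i y c] that by (simp add: dist_real_def)
      then show ?thesis using \<beta> by (simp add: dist_real_def)
    qed
    then show "\<exists>s>0. \<forall>x. x \<noteq> c \<and> dist x c < s \<longrightarrow> dist (X i x) (X i c) < e"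
      using \<beta> e by (intro exI[of _ "\<beta> * e"]) auto
  qed
  then have cont: "isCont (\<lambda>c. \<Sum>i\<in>UNIV. X i c) c" for c by (intro continuous_intros)
  obtain M where M: "\<And>i. M i \<ge> 0" "\<And>i c. c \<ge> M i \<Longrightarrow> stationary (f0 i) (f2 i) (lo i) (hi i) c (hi i)"
    "\<And>i c. c \<le> - M i \<Longrightarrow> stationary (f0 i) (f2 i) (lo i) (hi i) c (lo i)"
  proof -
    have "\<forall>i. \<exists>M\<ge>0. (\<forall>c\<ge>M. stationary (f0 i) (f2 i) (lo i) (hi i) c (hi i)) \<and>
        (\<forall>c\<le>-M. stationary (f0 i) (f2 i) (lo i) (hi i) c (lo i))"
      using stationary_endpoints box f2 by blast
    then show ?thesis using that by metis
  qed
  \<comment> \<open>The thresholds are nonnegative, so their sum dominates each of them: at prices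
    \<open>K\<close> and \<open>- K\<close> all buses sit at their upper and lower bounds
    simultaneously.\<close>
  define K where "K = (\<Sum>i\<in>UNIV. M i)"
  have K: "K \<ge> M i" for i unfolding K_def using M(1) by (intro member_le_sum) auto
  have "X i K = hi i" "X i (- K) = lo i" for i using unique M(2,3) K by auto
  moreover have "- K \<le> K" using M(1) unfolding K_def by (simp add: sum_nonneg)
  ultimately obtain c where "(\<Sum>i\<in>UNIV. X i c) = S"
    using IVT[of "\<lambda>c. \<Sum>i\<in>UNIV. X i c" "- K" S K] S cont by auto
  then show ?thesis using X by (intro exI[of _ c] exI[of _ "\<lambda>i. X i c"]) auto
qed

subsection \<open>Flows and the weighted Laplacian\<close>

text \<open>The linearized power flow for phase angles \<open>w\<close>. Its \<open>line_net\<close>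
  is the negative of the weighted graph Laplacian applied to \<open>w\<close>.\<close>

definition lap_flow :: "('n \<times> 'n \<Rightarrow> real) \<Rightarrow> ('n \<Rightarrow> real) \<Rightarrow> 'n \<times> 'n \<Rightarrow> real" where
  "lap_flow B w = (\<lambda>(a, b). B (a, b) * (w a - w b))"

text \<open>Summation by parts on the graph: \<open>line_net\<close> is the adjoint of the
  difference operator on potentials.\<close>

lemma sum_mult_line_net:
  fixes E :: "('n::finite \<times> 'n) set"
  shows "(\<Sum>i\<in>UNIV. x i * line_net E F i) = (\<Sum>(a, b)\<in>E. F (a, b) * (x b - x a))"
proof -
  have outflow: "(\<Sum>i\<in>UNIV. \<Sum>j\<in>{j. (i, j) \<in> E}. G i j) = (\<Sum>(i, j)\<in>E. G i j)" for G :: "'n \<Rightarrow> 'n \<Rightarrow> real"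
    by (subst sum.Sigma) (auto intro!: sum.cong)
  have "(\<Sum>i\<in>UNIV. \<Sum>k\<in>{k. (k, i) \<in> E}. G k i) = (\<Sum>(i, k)\<in>E\<inverse>. G k i)" for G :: "'n \<Rightarrow> 'n \<Rightarrow> real"
    by (subst sum.Sigma) (auto intro!: sum.cong)
  also have "(\<Sum>(i, k)\<in>E\<inverse>. G k i) = (\<Sum>(k, i)\<in>E. G k i)" for G :: "'n \<Rightarrow> 'n \<Rightarrow> real"
    by (rule sum.reindex_bij_witness[of _ prod.swap prod.swap]) auto
  finally have inflow: "(\<Sum>i\<in>UNIV. \<Sum>k\<in>{k. (k, i) \<in> E}. G k i) = (\<Sum>(k, i)\<in>E. G k i)"
    for G :: "'n \<Rightarrow> 'n \<Rightarrow> real" .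
  have "(\<Sum>i\<in>UNIV. x i * line_net E F i) = (\<Sum>i\<in>UNIV. \<Sum>k\<in>{k. (k, i) \<in> E}. F (k, i) * x i)
      - (\<Sum>i\<in>UNIV. \<Sum>j\<in>{j. (i, j) \<in> E}. F (i, j) * x i)"
    by (simp add: line_net_def sum_distrib_left right_diff_distrib sum_subtractf mult.commute)
  also have "\<dots> = (\<Sum>(a, b)\<in>E. F (a, b) * (x b - x a))"
    unfolding inflow outflow by (auto simp: sum_subtractf[symmetric] right_diff_distrib intro!: sum.cong)
  finally show ?thesis .
qed

lemma line_net_diff: "line_net E (\<lambda>ij. F ij - G ij) i = line_net E F i - line_net E G i"
  by (simp add: line_net_def sum_subtractf)

lemma line_net_tendsto:
  fixes E :: "('n::finite \<times> 'n) set"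
  assumes "\<And>ij. ij \<in> E \<Longrightarrow> ((\<lambda>t. F t ij) \<longlongrightarrow> G ij) A"
  shows "((\<lambda>t. line_net E (F t) i) \<longlongrightarrow> line_net E G i) A"
  unfolding line_net_def using assms by (intro tendsto_intros) auto

lemma line_net_has_derivative:
  fixes E :: "('n::finite \<times> 'n) set"
  assumes "\<And>ij. ij \<in> E \<Longrightarrow> ((\<lambda>t. F t ij) has_real_derivative G ij) A"
  shows "((\<lambda>t. line_net E (F t) i) has_real_derivative line_net E G i) A"
  unfolding line_net_def using assms by (intro derivative_intros) auto

lemma lap_flow_diff: "lap_flow B (\<lambda>i. v i - w i) = (\<lambda>ij. lap_flow B v ij - lap_flow B w ij)"
  by (auto simp: lap_flow_def fun_eq_iff algebra_simps)

lemma sum_line_net: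
  fixes E :: "('n::finite \<times> 'n) set"
  shows "(\<Sum>i\<in>UNIV. line_net E F i) = 0"
  using sum_mult_line_net[of "\<lambda>_. 1" E F] by simp

lemma laplacian_symmetric:
  fixes E :: "('n::finite \<times> 'n) set"
  shows "(\<Sum>i\<in>UNIV. v i * line_net E (lap_flow B w) i) = (\<Sum>i\<in>UNIV. w i * line_net E (lap_flow B v) i)"
  unfolding sum_mult_line_net by (auto simp: lap_flow_def algebra_simps intro!: sum.cong)

lemma weakly_connected_const:
  assumes "weakly_connected E" and step: "\<And>a b. (a, b) \<in> E \<Longrightarrow> w a = w b"
  shows "w i = w j"
proof -
  have "(i, j) \<in> (E \<union> E\<inverse>)\<^sup>*" using assms(1) unfolding weakly_connected_def by blast
  then show ?thesis by (induction rule: rtrancl_induct) (auto dest: step)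
qed

text \<open>Pairing with \<open>w\<close> gives the Dirichlet energy; it vanishes, so by positivity
  of \<open>B\<close> every line has equal potentials at its ends, and connectivity does the
  rest.\<close>

lemma laplacian_kernel:
  fixes E :: "('n::finite \<times> 'n) set"
  assumes conn: "weakly_connected E" and B: "\<And>ij. ij \<in> E \<Longrightarrow> B ij > 0"
    and ker: "\<And>i. line_net E (lap_flow B w) i = 0"
  shows "w i = w j"
proof (rule weakly_connected_const[OF conn])
  have "(\<Sum>(a, b)\<in>E. B (a, b) * (w a - w b)\<^sup>2) = - (\<Sum>i\<in>UNIV. w i * line_net E (lap_flow B w) i)"
    unfolding sum_mult_line_net sum_negf[symmetric]
    by (auto simp: lap_flow_def power2_eq_square algebra_simps intro!: sum.cong)
  then have z: "(\<Sum>(a, b)\<in>E. B (a, b) * (w a - w b)\<^sup>2) = 0" using ker by simp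
  fix a b assume ab: "(a, b) \<in> E"
  have "\<forall>ij\<in>E. (case ij of (a, b) \<Rightarrow> B (a, b) * (w a - w b)\<^sup>2) = 0"
    using z by (subst (asm) sum_nonneg_eq_0_iff) (auto simp: less_imp_le B)
  then show "w a = w b" using ab B[OF ab] by auto
qed

text \<open>The Laplacian is self-adjoint, so the component \<open>q\<close> of \<open>y\<close>
  orthogonal to its range lies in the kernel and is constant. Since \<open>y\<close> and the range
  have zero sum, so does \<open>q\<close>, and hence \<open>q = 0\<close>.\<close>

lemma laplacian_range:
  fixes E :: "('n::finite \<times> 'n) set"
  assumes conn: "weakly_connected E" and B: "\<And>ij. ij \<in> E \<Longrightarrow> B ij > 0"
    and y: "(\<Sum>i\<in>UNIV. y i) = 0"
  shows "\<exists>\<theta> :: real^'n. \<forall>i. line_net E (lap_flow B (\<lambda>j. \<theta> $ j)) i = y i"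
proof -
  define T :: "real^'n \<Rightarrow> real^'n" where "T \<theta> = (\<chi> i. line_net E (lap_flow B (\<lambda>j. \<theta> $ j)) i)" for \<theta>
  have "linear T"
    by (rule linearI) (auto simp: T_def vec_eq_iff line_net_def lap_flow_def sum.distrib sum_distrib_left
        algebra_simps sum_subtractf)
  then have sub: "subspace (range T)" by (simp add: linear_subspace_image)
  obtain p q where pq: "p \<in> range T" "\<And>w. w \<in> range T \<Longrightarrow> orthogonal q w" "(\<chi> i. y i) = p + q"
    using orthogonal_subspace_decomp_exists[of "range T" "\<chi> i. y i"] span_eq_iff[THEN iffD2, OF sub] by metis
  have "T q \<bullet> T q = q \<bullet> T (T q)"
    using laplacian_symmetric[of "\<lambda>i. T q $ i" E B "\<lambda>i. q $ i"]
    by (simp add: inner_vec_def T_def)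
  also have "\<dots> = 0" using pq(2) by (simp add: orthogonal_def)
  finally have "T q = 0" by simp
  then have "line_net E (lap_flow B (\<lambda>j. q $ j)) i = 0" for i
    by (metis T_def vec_lambda_beta zero_index)
  then have const: "q $ i = q $ j" for i j using laplacian_kernel[of E B "\<lambda>j. q $ j" i j] conn B by blast
  have "(\<Sum>i\<in>UNIV. p $ i) = 0" using pq(1) sum_line_net by (auto simp: T_def)
  moreover have "y i = p $ i + q $ i" for i using pq(3) by (metis vec_lambda_beta vector_add_component)
  ultimately have "(\<Sum>i\<in>UNIV. q $ i) = 0" using y by (simp add: sum.distrib)
  moreover have "(\<Sum>i\<in>UNIV. q $ i) = real CARD('n) * q $ j" for j
    by (subst sum.cong[OF refl const[of _ j]]) simp
  ultimately have "q $ j = 0" for j by simp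
  then have "y i = p $ i" for i using \<open>\<And>i. y i = p $ i + q $ i\<close> by simp
  then show ?thesis using pq(1) by (auto simp: T_def)
qed

subsection \<open>Equilibria\<close>

text \<open>The Slater condition enters through \<open>box\<close> and \<open>capacity\<close>: the
  total injection can be absorbed within the demand bounds.\<close>

locale dppd_network =
  fixes E :: "('n::finite \<times> 'n) set"
    and B :: "'n \<times> 'n \<Rightarrow> real" and D Pin dlo dhi :: "'n \<Rightarrow> real"
    and f0 f2 :: "'n \<Rightarrow> real \<Rightarrow> real" and \<kappa> \<beta> :: real
  assumes conn: "weakly_connected E"
    and B_pos: "ij \<in> E \<Longrightarrow> B ij > 0"
    and D_pos: "D i > 0"
    and kappa: "0 < \<kappa>" "\<kappa> < 1"
    and f0_diff: "f0 i differentiable (at x)"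
    and f2_convex: "convex_on UNIV (f2 i)"
    and beta: "\<beta> > 1"
    and f0_strongly_convex: "strongly_convex \<beta> (f0 i)"
    and box: "dlo i \<le> dhi i"
    and capacity: "(\<Sum>i\<in>UNIV. dlo i) \<le> (\<Sum>i\<in>UNIV. Pin i)" "(\<Sum>i\<in>UNIV. Pin i) \<le> (\<Sum>i\<in>UNIV. dhi i)"
begin

lemma u2_eq: "u2 E B Pin d \<theta> i = Pin i - d $ i + line_net E (lap_flow B (\<lambda>j. \<theta> $ j)) i"
  by (simp add: u2_def lap_flow_def)

lemma rhs_theta_eq:
  "rhs_theta E B Pin d \<theta> \<mu> i = - line_net E (lap_flow B (\<lambda>j. \<mu> $ j + u2 E B Pin d \<theta> j)) i"
  by (simp add: rhs_theta_def line_net_def lap_flow_def algebra_simps)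

lemma rhs_d_eq:
  "rhs_d E B D Pin f0 dlo dhi \<kappa> \<eta> d \<theta> P \<omega> \<mu> i =
     max (dlo i) (min (dhi i) (d$i + (- deriv (f0 i) (d$i) + \<kappa> * \<eta>$i + \<omega>$i + u1 E D Pin d \<omega> P i
        + \<mu>$i + u2 E B Pin d \<theta> i))) - d$i"
  unfolding rhs_d_def prox_ind_interval[OF box] by (simp add: algebra_simps)

abbreviation equilibrium where
  "equilibrium \<equiv> dppd_equilibrium E B D Pin f0 f2 dlo dhi \<kappa>"

lemma equilibrium_exists: "\<exists>\<eta> d \<theta> P \<omega> \<mu>. equilibrium \<eta> d \<theta> P \<omega> \<mu>"
proof -
  obtain c x where st: "\<And>i. stationary (f0 i) (f2 i) (dlo i) (dhi i) c (x i)"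
    and sum: "(\<Sum>i\<in>UNIV. x i) = (\<Sum>i\<in>UNIV. Pin i)"
    using stationary_resource_allocation[of \<beta> f0 f2 dlo dhi "\<Sum>i\<in>UNIV. Pin i"]
      beta f0_strongly_convex f0_diff f2_convex box capacity by auto
  obtain g where g: "\<And>i. subgrad (f2 i) (x i) (g i)"
    "\<And>i z. z \<in> {dlo i..dhi i} \<Longrightarrow> (c - deriv (f0 i) (x i) - g i) * (z - x i) \<le> 0"
    using st unfolding stationary_def by metis
  obtain \<theta> :: "real^'n" where \<theta>: "\<And>i. line_net E (lap_flow B (\<lambda>j. \<theta> $ j)) i = x i - Pin i"
    using laplacian_range[of E B "\<lambda>i. x i - Pin i"] conn B_pos sum by (auto simp: sum_subtractf)
  \<comment> \<open>With \<open>\<eta> = - g / \<kappa>\<close> the argument of the proximal map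
    becomes \<open>x + g\<close>, whose proximal point is \<open>x\<close>; a constant
    \<open>\<mu>\<close> supplies the price \<open>c\<close> at every bus.\<close>
  define \<eta> d \<omega> \<mu> :: "real^'n"
    where "\<eta> = (\<chi> i. - g i / \<kappa>)" and "d = (\<chi> i. x i)" and "\<omega> = 0" and "\<mu> = (\<chi> i. c)"
  \<comment> \<open>Taking the physical flow of \<open>\<theta>\<close> makes both balance residuals
    agree when \<open>\<omega> = 0\<close>, so they vanish together.\<close>
  define P where "P = lap_flow B (\<lambda>j. \<theta> $ j)"
  have u1: "u1 E D Pin d \<omega> P i = 0" for i by (simp add: u1_def d_def \<omega>_def P_def \<theta>)
  have u2: "u2 E B Pin d \<theta> i = 0" for i by (simp add: u2_eq d_def \<theta>)
  have "rhs_eta f2 \<kappa> \<eta> d i = 0" for i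
  proof -
    have "prox (\<lambda>x. ereal (f2 i x)) (x i + g i) = x i"
      by (rule prox_convex_eqI[OF f2_convex]) (simp add: g)
    then show ?thesis using kappa by (simp add: rhs_eta_def \<eta>_def d_def)
  qed
  moreover have "rhs_d E B D Pin f0 dlo dhi \<kappa> \<eta> d \<theta> P \<omega> \<mu> i = 0" for i
  proof -
    have "max (dlo i) (min (dhi i) (x i + (- deriv (f0 i) (x i) - g i + c))) = x i"
      using st[of i] g(2) unfolding stationary_def by (subst clamp_fixed_iff[OF box]) (auto simp: algebra_simps)
    then show ?thesis using kappa by (simp add: rhs_d_eq u1 u2) (simp add: \<eta>_def d_def \<omega>_def \<mu>_def)
  qed
  moreover have "rhs_theta E B Pin d \<theta> \<mu> i = 0" for i
    by (simp add: rhs_theta_eq u2 \<mu>_def line_net_def lap_flow_def)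
  ultimately show ?thesis
    unfolding dppd_equilibrium_def rhs_lambda_def rhs_mu_def rhs_P_def
    using u1 u2 by (intro exI[of _ \<eta>] exI[of _ d] exI[of _ \<theta>] exI[of _ P] exI[of _ \<omega>] exI[of _ \<mu>])
      (auto simp: \<omega>_def)
qed

lemma equilibriumD:
  assumes eq: "equilibrium \<eta> d \<theta> P \<omega> \<mu>"
  shows "u1 E D Pin d \<omega> P i = 0" "u2 E B Pin d \<theta> i = 0" "\<omega> $ i = 0" "\<mu> $ i = \<mu> $ j"
    "subgrad (f2 i) (d $ i) (- (\<kappa> * \<eta> $ i))" "d $ i \<in> {dlo i..dhi i}"
    "z \<in> {dlo i..dhi i} \<Longrightarrow> (- deriv (f0 i) (d$i) + \<kappa> * \<eta>$i + \<mu>$i) * (z - d$i) \<le> 0"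
proof -
  show u1: "u1 E D Pin d \<omega> P i = 0" for i
    using eq by (simp add: dppd_equilibrium_def rhs_lambda_def)
  show u2: "u2 E B Pin d \<theta> i = 0" for i
    using eq by (simp add: dppd_equilibrium_def rhs_mu_def)
  have "\<omega> $ a = \<omega> $ b" if "(a, b) \<in> E" for a b
    using eq that u1 unfolding dppd_equilibrium_def rhs_P_def by fastforce
  then have \<omega>c: "\<omega> $ i = \<omega> $ j" for i j using weakly_connected_const[OF conn, of "\<lambda>i. \<omega> $ i"] by blast
  \<comment> \<open>Network flows have zero total, and \<open>Pin - d\<close> cancels in the
    difference; what remains is the weighted sum of the constant \<open>\<omega>\<close>, which
    forces it to be zero.\<close>
  have "(\<Sum>i\<in>UNIV. u1 E D Pin d \<omega> P i) - (\<Sum>i\<in>UNIV. u2 E B Pin d \<theta> i) = - (\<Sum>i\<in>UNIV. D i * \<omega> $ i)"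
    unfolding u1_def u2_eq by (simp add: sum.distrib sum_subtractf sum_line_net)
  then have "(\<Sum>j\<in>UNIV. D j * \<omega> $ j) = 0" using u1 u2 by simp
  moreover have "(\<Sum>j\<in>UNIV. D j * \<omega> $ j) = (\<Sum>j\<in>UNIV. D j) * \<omega> $ i" for i
    unfolding sum_distrib_right by (rule sum.cong) (use \<omega>c in auto)
  moreover have "(\<Sum>j\<in>UNIV. D j) > 0" using D_pos by (intro sum_pos) auto
  ultimately show \<omega>0: "\<omega> $ i = 0" for i by (metis less_irrefl mult_eq_0_iff)
  have "line_net E (lap_flow B (\<lambda>j. \<mu> $ j)) i = 0" for i
    using eq u2 unfolding dppd_equilibrium_def rhs_theta_eq by simp
  then show "\<mu> $ i = \<mu> $ j" using laplacian_kernel[of E B "\<lambda>j. \<mu> $ j" i j] conn B_pos by blast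
  have "prox (\<lambda>x. ereal (f2 i x)) (d$i - \<kappa> * \<eta>$i) = d $ i"
    using eq by (simp add: dppd_equilibrium_def rhs_eta_def)
  then show "subgrad (f2 i) (d $ i) (- (\<kappa> * \<eta> $ i))"
    using prox_convex_subgrad[OF f2_convex, of i "d$i - \<kappa> * \<eta>$i"] by simp
  have "max (dlo i) (min (dhi i) (d$i + (- deriv (f0 i) (d$i) + \<kappa> * \<eta>$i + \<mu>$i))) = d $ i"
    using eq u1 u2 \<omega>0 unfolding dppd_equilibrium_def rhs_d_eq by simp
  from this[unfolded clamp_fixed_iff[OF box]]
  show "d $ i \<in> {dlo i..dhi i}"
    and "z \<in> {dlo i..dhi i} \<Longrightarrow> (- deriv (f0 i) (d$i) + \<kappa> * \<eta>$i + \<mu>$i) * (z - d$i) \<le> 0" by auto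
qed

text \<open>Lagrangian argument: the common value \<open>c\<close> of \<open>\<mu>\<close> is the
  multiplier of the total balance. Each bus minimizes its own Lagrangian, and the terms in
  \<open>c\<close> cancel on summation because both candidates are balanced.\<close>

lemma equilibrium_imp_optimal:
  assumes eq: "equilibrium \<eta> d \<theta> P \<omega> \<mu>"
  shows "rolc_optimal E B D Pin f0 f2 dlo dhi d \<theta> P \<omega>"
proof -
  note ED = equilibriumD[OF eq]
  have "rolc_feasible E B D Pin d \<theta> \<omega> P"
    unfolding rolc_feasible_def using ED(1,2) by (auto simp: u1_def algebra_simps)
  moreover have "rolc_objective D f0 f2 dlo dhi d \<omega> \<le> rolc_objective D f0 f2 dlo dhi d' \<omega>'"
    if feas: "rolc_feasible E B D Pin d' \<theta>' \<omega>' P'" for d' \<theta>' P' \<omega>'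
  proof (cases "\<forall>i. d' $ i \<in> {dlo i..dhi i}")
    case True
    define c where "c = \<mu> $ undefined"
    have c: "\<mu> $ i = c" for i unfolding c_def by (rule ED(4))
    have obj: "rolc_objective D f0 f2 dlo dhi x w =
        ereal (\<Sum>i\<in>UNIV. f0 i (x$i) + f2 i (x$i) + D i / 2 * (w$i)\<^sup>2)"
      if "\<forall>i. x $ i \<in> {dlo i..dhi i}" for x w
      using that by (simp add: rolc_objective_def ind_interval_def)
    have balance: "(\<Sum>i\<in>UNIV. x $ i) = (\<Sum>i\<in>UNIV. Pin i)" if "\<forall>i. u2 E B Pin x y i = 0" for x y
    proof -
      have "(\<Sum>i\<in>UNIV. u2 E B Pin x y i) = 0" using that by simp
      then show ?thesis unfolding u2_eq by (simp add: sum.distrib sum_subtractf sum_line_net)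
    qed
    have node: "f0 i (d$i) + f2 i (d$i) + D i / 2 * (\<omega>$i)\<^sup>2 + c * (d' $ i - d $ i)
        \<le> f0 i (d'$i) + f2 i (d'$i) + D i / 2 * (\<omega>'$i)\<^sup>2" for i
    proof -
      have "f0 i (d'$i) \<ge> f0 i (d$i) + deriv (f0 i) (d$i) * (d'$i - d$i) + \<beta> / 2 * (d'$i - d$i)\<^sup>2"
        using strongly_convex_tangent[OF f0_strongly_convex f0_diff] .
      moreover have "\<beta> / 2 * (d'$i - d$i)\<^sup>2 \<ge> 0" using beta by simp
      moreover have "f2 i (d'$i) \<ge> f2 i (d$i) + (- (\<kappa> * \<eta> $ i)) * (d'$i - d$i)"
        using ED(5)[of i] unfolding subgrad_def by blast
      moreover have "(- deriv (f0 i) (d$i) + \<kappa> * \<eta>$i + c) * (d'$i - d$i) \<le> 0"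
        using ED(7)[of "d' $ i" i] True c by auto
      then have "c * (d'$i - d$i) \<le> deriv (f0 i) (d$i) * (d'$i - d$i) + (- (\<kappa> * \<eta> $ i)) * (d'$i - d$i)"
        by (simp add: algebra_simps)
      moreover have "D i / 2 * (\<omega>'$i)\<^sup>2 \<ge> 0" using D_pos[of i] by simp
      moreover have "D i / 2 * (\<omega>$i)\<^sup>2 = 0" using ED(3) by simp
      ultimately show ?thesis by linarith
    qed
    have "(\<Sum>i\<in>UNIV. c * (d' $ i - d $ i)) = c * ((\<Sum>i\<in>UNIV. d' $ i) - (\<Sum>i\<in>UNIV. d $ i))"
      by (simp add: sum_distrib_left[symmetric] sum_subtractf)
    also have "\<dots> = 0" using balance[of d' \<theta>'] balance[of d \<theta>] feas ED(2) by (simp add: rolc_feasible_def)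
    finally have "(\<Sum>i\<in>UNIV. c * (d' $ i - d $ i)) = 0" .
    then have "(\<Sum>i\<in>UNIV. f0 i (d$i) + f2 i (d$i) + D i / 2 * (\<omega>$i)\<^sup>2)
        \<le> (\<Sum>i\<in>UNIV. f0 i (d'$i) + f2 i (d'$i) + D i / 2 * (\<omega>'$i)\<^sup>2)"
      using sum_mono[of UNIV "\<lambda>i. f0 i (d$i) + f2 i (d$i) + D i / 2 * (\<omega>$i)\<^sup>2 + c * (d' $ i - d $ i)", OF node]
      by (simp add: sum.distrib)
    then show ?thesis using obj[of d \<omega>] obj[OF True] ED(6) by simp
  next
    case False
    \<comment> \<open>Outside the box a single indicator term makes the competing objective
      infinite.\<close>
    then obtain j where "d' $ j \<notin> {dlo j..dhi j}" by blast
    then have "ereal (f0 j (d'$j)) + ind_interval (dlo j) (dhi j) (d'$j) + ereal (f2 j (d'$j))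
               + ereal (D j / 2 * (\<omega>'$j)\<^sup>2) = \<infinity>"
      unfolding ind_interval_def by (simp only: if_False) simp
    then have "rolc_objective D f0 f2 dlo dhi d' \<omega>' = \<infinity>"
      unfolding rolc_objective_def by (subst sum_Pinfty) auto
    then show ?thesis by simp
  qed
  ultimately show ?thesis unfolding rolc_optimal_def by blast
qed

end

subsection \<open>The Lyapunov function\<close>

text \<open>The coefficients of \<open>l\<close> squared and \<open>m\<close> squared are those for
  which the products \<open>l * a\<close> and \<open>m * b\<close> cancel in
  \<open>node_dissipation\<close>.\<close>

definition node_energy :: "real \<Rightarrow> real \<Rightarrow> real \<Rightarrow> real \<Rightarrow> real \<Rightarrow> real \<Rightarrow> real \<Rightarrow> real \<Rightarrow> real \<Rightarrow> real \<Rightarrow> real" where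
  "node_energy \<kappa> D e x r h l m a b =
     \<kappa> / 2 * e\<^sup>2 + x\<^sup>2 / 2 - \<kappa> * (e * x) + r + h\<^sup>2 / 2 + (1 + 3 / 2 * D) * l\<^sup>2 + m\<^sup>2
     + a\<^sup>2 / 2 + l * a + b\<^sup>2 / 2 + m * b"

text \<open>Completing squares absorbs the cross terms into \<open>e / 2 - x\<close>,
  \<open>l + a\<close> and \<open>m + b\<close>. The quadratic growth of \<open>r\<close> supplies
  the additional square of \<open>x\<close> that the first of these uses.\<close>

lemma node_energy_lower_bound:
  assumes "0 < \<kappa>" "D > 0" "\<beta> > 1" "r \<ge> \<beta> / 2 * x\<^sup>2"
  shows "\<kappa> / 4 * e\<^sup>2 + (1 - \<kappa>) * x\<^sup>2 + h\<^sup>2 / 2 + l\<^sup>2 / 2 + m\<^sup>2 / 2 \<le> node_energy \<kappa> D e x r h l m a b"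
proof -
  have "node_energy \<kappa> D e x r h l m a b
      = \<kappa> / 4 * e\<^sup>2 + (1 - \<kappa>) * x\<^sup>2 + h\<^sup>2 / 2 + l\<^sup>2 / 2 + m\<^sup>2 / 2
        + (\<kappa> * (e / 2 - x)\<^sup>2 + (r - \<beta> / 2 * x\<^sup>2) + (\<beta> - 1) / 2 * x\<^sup>2 + (l + a)\<^sup>2 / 2 + 3 / 2 * D * l\<^sup>2 + (m + b)\<^sup>2 / 2)"
    by (simp add: node_energy_def power2_eq_square field_simps)
  moreover have "\<kappa> * (e / 2 - x)\<^sup>2 \<ge> 0" "(\<beta> - 1) / 2 * x\<^sup>2 \<ge> 0" "3 / 2 * D * l\<^sup>2 \<ge> 0"
    using assms by auto
  ultimately show ?thesis using assms(4) by (simp add: add_nonneg_nonneg)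
qed

lemma node_energy_has_derivative:
  assumes "(e has_real_derivative e') (at t within S)" "(x has_real_derivative x') (at t within S)"
    "(r has_real_derivative r') (at t within S)" "(h has_real_derivative h') (at t within S)"
    "(l has_real_derivative l') (at t within S)" "(m has_real_derivative m') (at t within S)"
    "(a has_real_derivative a') (at t within S)" "(b has_real_derivative b') (at t within S)"
  shows "((\<lambda>s. node_energy \<kappa> D (e s) (x s) (r s) (h s) (l s) (m s) (a s) (b s)) has_real_derivative
     \<kappa> * (e t * e') + x t * x' - \<kappa> * (e' * x t + e t * x') + r' + h t * h' + (2 + 3 * D) * l t * l' + 2 * m t * m'
     + (a t + l t) * a' + l' * a t + (b t + m t) * b' + m' * b t) (at t within S)"
  unfolding node_energy_def
  by (rule derivative_eq_intros assms refl | simp)+ (simp add: field_simps)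

text \<open>An exact identity: the left side is the claimed bound minus nonnegative squares and
  minus the slacks of \<open>I1\<close>, \<open>I2\<close>, \<open>I3\<close>. These come from the
  proximal map, the projection and strong convexity; \<open>\<kappa> < 1 < \<beta>\<close> makes the
  coefficient of \<open>x\<close> squared positive. The last three terms on the left are what
  summation by parts over the network contributes.\<close>

lemma node_dissipation:
  fixes e e' x x' g l m a b h' D \<kappa> \<beta> :: real
  assumes "0 < \<kappa>" "\<kappa> < 1" "D > 0" "\<beta> > 1"
    and I1: "(- \<kappa> * e - e') * (e' + x) \<ge> 0"
    and I2: "(- x' - (g - \<kappa> * e - l - a - m - b)) * (x + x') \<ge> 0"
    and I3: "g * x \<ge> \<beta> * x\<^sup>2"
  shows "\<kappa> * (e * e') + x * x' - \<kappa> * (e' * x + e * x') + g * x' + (2 + 3 * D) * l * (a / 2) + 2 * m * (b / 2)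
      + (a + l) * (- x' - D * (a / 2)) + a / 2 * a + (b + m) * (- x') + b / 2 * b
      - (m + b) * (b + x) - h'\<^sup>2 - (l + a) * (a + x + D * l)
    \<le> - ((1 - \<kappa>) / 2 * e'\<^sup>2 + x'\<^sup>2 + a\<^sup>2 / 2 + b\<^sup>2 / 2 + h'\<^sup>2)" (is "?r \<le> _")
proof -
  have "?r = - ((1 - \<kappa>) / 2 * e'\<^sup>2 + x'\<^sup>2 + a\<^sup>2 / 2 + b\<^sup>2 / 2 + h'\<^sup>2)
      - ((1 + \<kappa>) / 2 * (e' + x)\<^sup>2 + (\<beta> - (1 + \<kappa>) / 2) * x\<^sup>2 + D * l\<^sup>2 + D / 2 * a\<^sup>2)
      - (- \<kappa> * e - e') * (e' + x) - (- x' - (g - \<kappa> * e - l - a - m - b)) * (x + x') - (g * x - \<beta> * x\<^sup>2)"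
    by (simp add: power2_eq_square field_simps)
  moreover have "(1 + \<kappa>) / 2 * (e' + x)\<^sup>2 \<ge> 0" "(\<beta> - (1 + \<kappa>) / 2) * x\<^sup>2 \<ge> 0" "D * l\<^sup>2 \<ge> 0" "D / 2 * a\<^sup>2 \<ge> 0"
    using assms(1-4) by auto
  ultimately show ?thesis using I1 I2 I3 by linarith
qed

section \<open>Decrease of the Lyapunov function along trajectories\<close>

context dppd_network
begin

abbreviation trajectory where
  "trajectory \<equiv> dppd_trajectory E B D Pin f0 f2 dlo dhi \<kappa>"

definition lyap where
  "lyap \<eta>s ds \<theta>s Ps \<omega>s \<mu>s \<eta> d \<theta> P \<omega> \<mu> =
    (\<Sum>i\<in>UNIV. node_energy \<kappa> (D i) (\<eta>$i - \<eta>s$i) (d$i - ds$i)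
        (f0 i (d$i) - f0 i (ds$i) - deriv (f0 i) (ds$i) * (d$i - ds$i))
        (\<theta>$i - \<theta>s$i) (\<omega>$i - \<omega>s$i) (\<mu>$i - \<mu>s$i) (u1 E D Pin d \<omega> P i) (u2 E B Pin d \<theta> i))
    + (\<Sum>ij\<in>E. (P ij - Ps ij)\<^sup>2 / 2)"

definition dissipation where
  "dissipation \<eta> d \<theta> P \<omega> \<mu> =
    (\<Sum>i\<in>UNIV. (1 - \<kappa>) / 2 * (rhs_eta f2 \<kappa> \<eta> d i)\<^sup>2
       + (rhs_d E B D Pin f0 dlo dhi \<kappa> \<eta> d \<theta> P \<omega> \<mu> i)\<^sup>2
       + (u1 E D Pin d \<omega> P i)\<^sup>2 / 2 + (u2 E B Pin d \<theta> i)\<^sup>2 / 2 + (rhs_theta E B Pin d \<theta> \<mu> i)\<^sup>2)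
    + (\<Sum>ij\<in>E. (rhs_P E D Pin d P \<omega> ij)\<^sup>2)"

lemma lyap_decreasing:
  fixes \<eta> d \<theta> \<omega> \<mu> :: "real \<Rightarrow> real^'n" and P :: "real \<Rightarrow> 'n \<times> 'n \<Rightarrow> real"
  assumes eq: "equilibrium \<eta>s ds \<theta>s Ps \<omega>s \<mu>s" and traj: "trajectory \<eta> d \<theta> P \<omega> \<mu>" and t: "t \<ge> 0"
  shows "\<exists>v. ((\<lambda>s. lyap \<eta>s ds \<theta>s Ps \<omega>s \<mu>s (\<eta> s) (d s) (\<theta> s) (P s) (\<omega> s) (\<mu> s)) has_real_derivative v)
      (at t within {0..}) \<and> v \<le> - dissipation (\<eta> t) (d t) (\<theta> t) (P t) (\<omega> t) (\<mu> t)"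
proof -
  note ED = equilibriumD[OF eq]
  let ?F = "at t within {0..}"
  \<comment> \<open>Primes denote time derivatives at \<open>t\<close>; \<open>e x h l m p\<close>
    are deviations from the equilibrium, and \<open>a b\<close> are the residuals, which vanish
    there.\<close>
  define e' where "e' i = rhs_eta f2 \<kappa> (\<eta> t) (d t) i" for i
  define x' where "x' i = rhs_d E B D Pin f0 dlo dhi \<kappa> (\<eta> t) (d t) (\<theta> t) (P t) (\<omega> t) (\<mu> t) i" for i
  define h' where "h' i = rhs_theta E B Pin (d t) (\<theta> t) (\<mu> t) i" for i
  define p' where "p' = rhs_P E D Pin (d t) (P t) (\<omega> t)"
  define a where "a i = u1 E D Pin (d t) (\<omega> t) (P t) i" for i
  define b where "b i = u2 E B Pin (d t) (\<theta> t) i" for i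
  define e where "e i = \<eta> t $ i - \<eta>s $ i" for i
  define x where "x i = d t $ i - ds $ i" for i
  define h where "h i = \<theta> t $ i - \<theta>s $ i" for i
  define l where "l i = \<omega> t $ i - \<omega>s $ i" for i
  define m where "m i = \<mu> t $ i - \<mu>s $ i" for i
  define p where "p ij = P t ij - Ps ij" for ij
  define g where "g i = deriv (f0 i) (d t $ i) - deriv (f0 i) (ds $ i)" for i
  define a' where "a' i = - x' i - D i * (a i / 2) + line_net E p' i" for i
  define b' where "b' i = - x' i + line_net E (lap_flow B h') i" for i
  have d\<eta>: "((\<lambda>s. \<eta> s $ i) has_real_derivative e' i) ?F"
    and dd: "((\<lambda>s. d s $ i) has_real_derivative x' i) ?F"
    and d\<theta>: "((\<lambda>s. \<theta> s $ i) has_real_derivative h' i) ?F"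
    and d\<omega>: "((\<lambda>s. \<omega> s $ i) has_real_derivative a i / 2) ?F"
    and d\<mu>: "((\<lambda>s. \<mu> s $ i) has_real_derivative b i / 2) ?F" for i
    using traj t unfolding dppd_trajectory_def rhs_lambda_def rhs_mu_def e'_def x'_def h'_def a_def b_def
    by auto
  have dP: "((\<lambda>s. P s ij) has_real_derivative p' ij) ?F" if "ij \<in> E" for ij
    using traj t that unfolding dppd_trajectory_def p'_def by auto
  have df0: "((\<lambda>s. f0 i (d s $ i)) has_real_derivative deriv (f0 i) (d t $ i) * x' i) ?F" for i
    using f0_diff by (intro DERIV_chain2[OF _ dd]) (simp add: DERIV_deriv_iff_real_differentiable)
  have du1: "((\<lambda>s. u1 E D Pin (d s) (\<omega> s) (P s) i) has_real_derivative a' i) ?F" for i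
    unfolding u1_def a'_def
    by (rule derivative_eq_intros dd d\<omega> line_net_has_derivative[OF dP] refl | assumption | simp)+
  have "((\<lambda>s. lap_flow B (\<lambda>j. \<theta> s $ j) ij) has_real_derivative lap_flow B h' ij) ?F" for ij
    unfolding lap_flow_def by (cases ij) (auto intro!: derivative_eq_intros d\<theta>)
  then have du2: "((\<lambda>s. u2 E B Pin (d s) (\<theta> s) i) has_real_derivative b' i) ?F" for i
    unfolding u2_eq b'_def
    by (auto intro!: derivative_eq_intros dd line_net_has_derivative)
  define v where "v i = \<kappa> * (e i * e' i) + x i * x' i - \<kappa> * (e' i * x i + e i * x' i) + g i * x' i
      + h i * h' i + (2 + 3 * D i) * l i * (a i / 2) + 2 * m i * (b i / 2)
      + (a i + l i) * a' i + a i / 2 * a i + (b i + m i) * b' i + b i / 2 * b i" for i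
  have node: "((\<lambda>s. node_energy \<kappa> (D i) (\<eta> s $ i - \<eta>s$i) (d s $ i - ds$i)
        (f0 i (d s $ i) - f0 i (ds$i) - deriv (f0 i) (ds$i) * (d s $ i - ds$i))
        (\<theta> s $ i - \<theta>s$i) (\<omega> s $ i - \<omega>s$i) (\<mu> s $ i - \<mu>s$i) (u1 E D Pin (d s) (\<omega> s) (P s) i)
        (u2 E B Pin (d s) (\<theta> s) i)) has_real_derivative v i) ?F" for i
    unfolding v_def a_def b_def e_def x_def h_def l_def m_def
    by (rule node_energy_has_derivative)
      (auto intro!: derivative_eq_intros d\<eta> dd df0 d\<theta> d\<omega>[unfolded a_def] d\<mu>[unfolded b_def] du1 du2
        simp: g_def algebra_simps)
  have edge: "((\<lambda>s. (P s ij - Ps ij)\<^sup>2 / 2) has_real_derivative p ij * p' ij) ?F" if "ij \<in> E" for ij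
    unfolding p_def using dP[OF that] by (auto intro!: derivative_eq_intros)
  have der: "((\<lambda>s. lyap \<eta>s ds \<theta>s Ps \<omega>s \<mu>s (\<eta> s) (d s) (\<theta> s) (P s) (\<omega> s) (\<mu> s))
      has_real_derivative (\<Sum>i\<in>UNIV. v i) + (\<Sum>ij\<in>E. p ij * p' ij)) ?F"
    unfolding lyap_def by (intro DERIV_add DERIV_sum node edge)
  \<comment> \<open>Subtracting the balance equations of the equilibrium expresses the net flow
    deviations through nodal quantities.\<close>
  have a_eq: "line_net E p i = a i + x i + D i * l i" for i
    using ED(1)[of i] unfolding p_def line_net_diff a_def x_def l_def u1_def by (simp add: algebra_simps)
  have b_eq: "line_net E (lap_flow B h) i = b i + x i" for i
    using ED(2)[of i] unfolding h_def lap_flow_diff line_net_diff b_def x_def u2_eq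
    by (simp add: algebra_simps)
  \<comment> \<open>As \<open>\<mu>s\<close> is constant over the buses, \<open>\<mu>\<close> and
    its deviation \<open>m\<close> have the same differences along lines.\<close>
  have h'_eq: "h' i = - line_net E (lap_flow B (\<lambda>j. b j + m j)) i" for i
  proof -
    have "lap_flow B (\<lambda>j. \<mu> t $ j + b j) = lap_flow B (\<lambda>j. b j + m j)"
      unfolding lap_flow_def m_def using ED(4) by (auto simp: fun_eq_iff)
    then show ?thesis unfolding h'_def rhs_theta_eq b_def by simp
  qed
  have p'_eq: "p' (i, j) = (a i + l i) - (a j + l j)" for i j
    unfolding p'_def rhs_P_def a_def l_def using ED(3) by simp
  \<comment> \<open>The network terms are handled only after summation: \<open>G1\<close> and
    \<open>G3\<close> turn the storage terms of \<open>\<theta>\<close> and \<open>P\<close> into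
    nodal products, \<open>G2\<close> and \<open>G4\<close> produce the negative squares of
    \<open>h'\<close> and \<open>p'\<close>.\<close>
  have G1: "(\<Sum>i\<in>UNIV. h i * h' i) = (\<Sum>i\<in>UNIV. - ((m i + b i) * (b i + x i)))"
  proof -
    have "(\<Sum>i\<in>UNIV. h i * h' i) = - (\<Sum>i\<in>UNIV. (b i + m i) * line_net E (lap_flow B h) i)"
      unfolding h'_eq laplacian_symmetric[of "\<lambda>i. b i + m i"] by (simp add: sum_negf)
    then show ?thesis by (simp add: b_eq sum_negf add.commute)
  qed
  have G2: "(\<Sum>i\<in>UNIV. (b i + m i) * line_net E (lap_flow B h') i) = (\<Sum>i\<in>UNIV. - (h' i)\<^sup>2)"
    unfolding laplacian_symmetric[of "\<lambda>i. b i + m i"]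
    by (rule sum.cong) (simp_all add: h'_eq power2_eq_square)
  have G3: "(\<Sum>ij\<in>E. p ij * p' ij) = (\<Sum>i\<in>UNIV. - ((l i + a i) * (a i + x i + D i * l i)))"
  proof -
    have "(\<Sum>ij\<in>E. p ij * p' ij) = - (\<Sum>i\<in>UNIV. (a i + l i) * line_net E p i)"
      unfolding sum_mult_line_net sum_negf[symmetric]
      by (auto simp: p'_eq algebra_simps intro!: sum.cong)
    then show ?thesis by (simp add: a_eq sum_negf add.commute)
  qed
  have G4: "(\<Sum>i\<in>UNIV. (a i + l i) * line_net E p' i) = - (\<Sum>ij\<in>E. (p' ij)\<^sup>2)"
    unfolding sum_mult_line_net sum_negf[symmetric]
    by (auto simp: p'_eq power2_eq_square algebra_simps intro!: sum.cong)
  \<comment> \<open>The part of \<open>v\<close> left after removing every term that couples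
    buses.\<close>
  define c where "c i = \<kappa> * (e i * e' i) + x i * x' i - \<kappa> * (e' i * x i + e i * x' i) + g i * x' i
      + (2 + 3 * D i) * l i * (a i / 2) + 2 * m i * (b i / 2)
      + (a i + l i) * (- x' i - D i * (a i / 2)) + a i / 2 * a i + (b i + m i) * (- x' i) + b i / 2 * b i" for i
  have "v i = c i + h i * h' i + (b i + m i) * line_net E (lap_flow B h') i + (a i + l i) * line_net E p' i" for i
    unfolding v_def c_def a'_def b'_def by (simp add: algebra_simps)
  then have "(\<Sum>i\<in>UNIV. v i) + (\<Sum>ij\<in>E. p ij * p' ij)
     = (\<Sum>i\<in>UNIV. c i - (m i + b i) * (b i + x i) - (h' i)\<^sup>2 - (l i + a i) * (a i + x i + D i * l i)) - (\<Sum>ij\<in>E. (p' ij)\<^sup>2)"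
    using G1 G2 G3 G4 by (simp add: sum.distrib sum_subtractf sum_negf)
  also have "\<dots> \<le> (\<Sum>i\<in>UNIV. - ((1 - \<kappa>) / 2 * (e' i)\<^sup>2 + (x' i)\<^sup>2 + (a i)\<^sup>2 / 2 + (b i)\<^sup>2 / 2 + (h' i)\<^sup>2)) - (\<Sum>ij\<in>E. (p' ij)\<^sup>2)"
  proof (intro diff_mono sum_mono order_refl)
    fix i
    \<comment> \<open>The proximal point \<open>d + e'\<close> carries a subgradient of
      \<open>f2\<close>; comparing it with the one at the equilibrium gives
      \<open>I1\<close>.\<close>
    have "subgrad (f2 i) (d t $ i + e' i) (d t $ i - \<kappa> * \<eta> t $ i - (d t $ i + e' i))"
      using prox_convex_subgrad[OF f2_convex, of i "d t $ i - \<kappa> * \<eta> t $ i"]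
      unfolding e'_def rhs_eta_def by simp
    from subgrad_mono[OF this ED(5)[of i]]
    have I1: "(- \<kappa> * e i - e' i) * (e' i + x i) \<ge> 0"
      unfolding e_def x_def by (simp add: algebra_simps)
    define G where "G = - deriv (f0 i) (d t $ i) + \<kappa> * \<eta> t $ i + \<omega> t $ i + a i + \<mu> t $ i + b i"
    have q: "d t $ i + x' i = max (dlo i) (min (dhi i) (d t $ i + G))"
      unfolding x'_def rhs_d_eq G_def a_def b_def by simp
    \<comment> \<open>The projection inequality is tested at \<open>ds\<close>, and the normal-cone
      inequality of the equilibrium at the projected point; their difference is
      \<open>I2\<close>.\<close>
    have "(d t $ i + G - (d t $ i + x' i)) * (d t $ i + x' i - ds $ i) \<ge> 0"
      unfolding q using ED(6)[of i] by (intro clamp_variational) auto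
    moreover have "(- deriv (f0 i) (ds $ i) + \<kappa> * \<eta>s $ i + \<mu>s $ i) * (d t $ i + x' i - ds $ i) \<le> 0"
      by (rule ED(7)) (use q box[of i] in auto)
    ultimately have "(G - x' i - (- deriv (f0 i) (ds $ i) + \<kappa> * \<eta>s $ i + \<mu>s $ i)) * (x i + x' i) \<ge> 0"
      unfolding x_def by (simp add: algebra_simps)
    moreover have "G - x' i - (- deriv (f0 i) (ds $ i) + \<kappa> * \<eta>s $ i + \<mu>s $ i)
        = - x' i - (g i - \<kappa> * e i - l i - a i - m i - b i)"
      unfolding G_def g_def e_def l_def m_def using ED(3) by (simp add: algebra_simps)
    ultimately have I2: "(- x' i - (g i - \<kappa> * e i - l i - a i - m i - b i)) * (x i + x' i) \<ge> 0" by (simp only:)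
    have I3: "g i * x i \<ge> \<beta> * (x i)\<^sup>2"
      unfolding g_def x_def using strongly_convex_deriv_mono[OF f0_strongly_convex f0_diff f0_diff] .
    show "c i - (m i + b i) * (b i + x i) - (h' i)\<^sup>2 - (l i + a i) * (a i + x i + D i * l i)
        \<le> - ((1 - \<kappa>) / 2 * (e' i)\<^sup>2 + (x' i)\<^sup>2 + (a i)\<^sup>2 / 2 + (b i)\<^sup>2 / 2 + (h' i)\<^sup>2)"
      unfolding c_def by (rule node_dissipation[OF kappa D_pos beta I1 I2 I3])
  qed
  also have "\<dots> = - dissipation (\<eta> t) (d t) (\<theta> t) (P t) (\<omega> t) (\<mu> t)"
    unfolding dissipation_def sum_negf e'_def x'_def h'_def p'_def a_def b_def by simp
  finally show ?thesis using der by blast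
qed

end

section \<open>Decay at a given rate, and auxiliary limits and bounds\<close>

lemma decrease_at_rate:
  fixes f :: "real \<Rightarrow> real"
  assumes st: "0 \<le> s" "s \<le> t"
    and der: "\<And>r. s \<le> r \<Longrightarrow> \<exists>v. (f has_real_derivative v) (at r within {0..}) \<and> v \<le> - \<delta>"
  shows "f t \<le> f s - \<delta> * (t - s)"
proof -
  \<comment> \<open>Adding \<open>\<delta> * r\<close> reduces the claim to monotonicity. The
    derivative is one-sided at time \<open>0\<close>, so derivatives are taken in the open interval
    and only continuity at its ends.\<close>
  have "f s + \<delta> * s \<ge> f t + \<delta> * t"
  proof (rule DERIV_nonpos_imp_decreasing_open[OF st(2)])
    fix x assume x: "s < x"
    obtain v where v: "(f has_real_derivative v) (at x within {0..})" "v \<le> - \<delta>"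
      using der[OF less_imp_le[OF x(1)]] by blast
    have "x \<in> interior {0..}" using x st by (intro interiorI[of "{0<..}"]) auto
    from v(1)[unfolded at_within_interior[OF this]]
    have "((\<lambda>r. f r + \<delta> * r) has_real_derivative v + \<delta>) (at x)"
      by (rule DERIV_add) (rule DERIV_cmult_Id)
    moreover have "v + \<delta> \<le> 0" using v(2) by simp
    ultimately show "\<exists>y. ((\<lambda>r. f r + \<delta> * r) has_real_derivative y) (at x) \<and> y \<le> 0" by blast
  next
    have "continuous_on {s..t} f"
      unfolding continuous_on_eq_continuous_within
    proof
      fix r assume "r \<in> {s..t}"
      then have "s \<le> r" by simp
      then obtain v where "(f has_real_derivative v) (at r within {0..})" using der by blast
      then have "continuous (at r within {0..}) f" by (rule DERIV_continuous)
      then show "continuous (at r within {s..t}) f"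
        by (rule continuous_within_subset) (use st in auto)
    qed
    then show "continuous_on {s..t} (\<lambda>r. f r + \<delta> * r)" by (intro continuous_intros)
  qed
  then show ?thesis by (simp add: algebra_simps)
qed

lemma tendsto_of_square_bound:
  fixes y V :: "'a \<Rightarrow> real"
  assumes c: "c > 0" and V: "(V \<longlongrightarrow> 0) A" and bd: "eventually (\<lambda>t. c * (y t - z)\<^sup>2 \<le> V t) A"
  shows "(y \<longlongrightarrow> z) A"
proof -
  have "((\<lambda>t. V t / c) \<longlongrightarrow> 0 / c) A" using c by (intro tendsto_intros V) simp
  then have V': "((\<lambda>t. V t / c) \<longlongrightarrow> 0) A" by simp
  have "((\<lambda>t. (y t - z)\<^sup>2) \<longlongrightarrow> 0) A"
    by (rule tendsto_sandwich[OF _ _ tendsto_const V'])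
      (use bd c in \<open>auto elim!: eventually_mono simp: field_simps\<close>)
  from tendsto_real_sqrt[OF this] have "((\<lambda>t. \<bar>y t - z\<bar>) \<longlongrightarrow> 0) A" by simp
  then have "((\<lambda>t. y t - z) \<longlongrightarrow> 0) A" by (rule tendsto_rabs_zero_cancel)
  then show ?thesis by (rule LIM_zero_cancel)
qed

lemma bounded_vec_box: "bounded {x :: real^'m. \<forall>i. \<bar>x $ i\<bar> \<le> M}"
proof -
  have "norm x \<le> real CARD('m) * M" if "\<forall>i. \<bar>x $ i\<bar> \<le> M" for x :: "real^'m"
  proof -
    have "norm x \<le> (\<Sum>i\<in>UNIV. \<bar>x $ i\<bar>)" by (rule norm_le_l1_cart)
    also have "\<dots> \<le> (\<Sum>i\<in>(UNIV::'m set). M)" using that by (intro sum_mono) auto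
    finally show ?thesis by simp
  qed
  then show ?thesis unfolding bounded_iff by blast
qed

lemma node_energy_tendsto:
  fixes A :: "'a filter"
  assumes "(e \<longlongrightarrow> e') A" "(x \<longlongrightarrow> x') A" "(r \<longlongrightarrow> r') A" "(h \<longlongrightarrow> h') A" "(l \<longlongrightarrow> l') A" "(m \<longlongrightarrow> m') A"
    "(a \<longlongrightarrow> a') A" "(b \<longlongrightarrow> b') A"
  shows "((\<lambda>t. node_energy \<kappa> D (e t) (x t) (r t) (h t) (l t) (m t) (a t) (b t))
    \<longlongrightarrow> node_energy \<kappa> D e' x' r' h' l' m' a' b') A"
proof -
  have half: "((\<lambda>t. y t / 2) \<longlongrightarrow> z / 2) A" if "(y \<longlongrightarrow> z) A" for y :: "'a \<Rightarrow> real" and z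
    using that by (rule tendsto_divide[OF _ tendsto_const]) simp
  show ?thesis unfolding node_energy_def
    by (intro tendsto_add tendsto_diff half tendsto_power tendsto_mult tendsto_const assms)
qed

text \<open>The variables stand for squared deviations, which leaves only linear arithmetic.\<close>

lemma weighted_sum_bounds:
  fixes c \<kappa> e x h l m n :: real
  assumes n: "\<kappa> / 4 * e + (1 - \<kappa>) * x + h / 2 + l / 2 + m / 2 \<le> n"
    and c: "c > 0" "c \<le> \<kappa> / 4" "c \<le> 1 - \<kappa>" "c \<le> 1 / 2"
    and nonneg: "e \<ge> 0" "x \<ge> 0" "h \<ge> 0" "l \<ge> 0" "m \<ge> 0"
  shows "0 \<le> n \<and> c * e \<le> n \<and> c * x \<le> n \<and> c * h \<le> n \<and> c * l \<le> n \<and> c * m \<le> n"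
proof -
  have le: "c * e \<le> \<kappa> / 4 * e" "c * x \<le> (1 - \<kappa>) * x" "c * h \<le> 1 / 2 * h" "c * l \<le> 1 / 2 * l" "c * m \<le> 1 / 2 * m"
    using mult_right_mono[OF c(2) nonneg(1)] mult_right_mono[OF c(3) nonneg(2)] mult_right_mono[OF c(4) nonneg(3)]
      mult_right_mono[OF c(4) nonneg(4)] mult_right_mono[OF c(4) nonneg(5)] by simp_all
  have "0 \<le> c * e" "0 \<le> c * x" "0 \<le> c * h" "0 \<le> c * l" "0 \<le> c * m" using c(1) nonneg by simp_all
  then show ?thesis using le n by (intro conjI) linarith+
qed

section \<open>Coercivity of the Lyapunov function, and continuity of it and of the
  dissipation\<close>

context dppd_network
begin

lemma lyap_coercive:
  "\<exists>c>0. \<forall>\<eta> d \<theta> P \<omega> \<mu>.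
     (\<forall>i. c * (\<eta>$i - \<eta>s$i)\<^sup>2 \<le> lyap \<eta>s ds \<theta>s Ps \<omega>s \<mu>s \<eta> d \<theta> P \<omega> \<mu> \<and>
          c * (d$i - ds$i)\<^sup>2 \<le> lyap \<eta>s ds \<theta>s Ps \<omega>s \<mu>s \<eta> d \<theta> P \<omega> \<mu> \<and>
          c * (\<theta>$i - \<theta>s$i)\<^sup>2 \<le> lyap \<eta>s ds \<theta>s Ps \<omega>s \<mu>s \<eta> d \<theta> P \<omega> \<mu> \<and>
          c * (\<omega>$i - \<omega>s$i)\<^sup>2 \<le> lyap \<eta>s ds \<theta>s Ps \<omega>s \<mu>s \<eta> d \<theta> P \<omega> \<mu> \<and>
          c * (\<mu>$i - \<mu>s$i)\<^sup>2 \<le> lyap \<eta>s ds \<theta>s Ps \<omega>s \<mu>s \<eta> d \<theta> P \<omega> \<mu>) \<and>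
     (\<forall>ij\<in>E. c * (P ij - Ps ij)\<^sup>2 \<le> lyap \<eta>s ds \<theta>s Ps \<omega>s \<mu>s \<eta> d \<theta> P \<omega> \<mu>)"
proof -
  \<comment> \<open>The smallest coefficient in \<open>node_energy_lower_bound\<close>, where
    \<open>1 / 2\<close> also covers the line terms.\<close>
  define c where "c = min (\<kappa> / 4) (min (1 - \<kappa>) (1 / 2))"
  have c: "c > 0" "c \<le> \<kappa> / 4" "c \<le> 1 - \<kappa>" "c \<le> 1 / 2" using kappa unfolding c_def by linarith+
  have main: "(\<forall>i. c * (\<eta>$i - \<eta>s$i)\<^sup>2 \<le> L \<and> c * (d$i - ds$i)\<^sup>2 \<le> L \<and> c * (\<theta>$i - \<theta>s$i)\<^sup>2 \<le> L \<and>
      c * (\<omega>$i - \<omega>s$i)\<^sup>2 \<le> L \<and> c * (\<mu>$i - \<mu>s$i)\<^sup>2 \<le> L) \<and> (\<forall>ij\<in>E. c * (P ij - Ps ij)\<^sup>2 \<le> L)"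
    if L: "L = lyap \<eta>s ds \<theta>s Ps \<omega>s \<mu>s \<eta> d \<theta> P \<omega> \<mu>" for L \<eta> d \<theta> P \<omega> \<mu>
  proof -
    define n where "n i = node_energy \<kappa> (D i) (\<eta>$i - \<eta>s$i) (d$i - ds$i)
        (f0 i (d$i) - f0 i (ds$i) - deriv (f0 i) (ds$i) * (d$i - ds$i))
        (\<theta>$i - \<theta>s$i) (\<omega>$i - \<omega>s$i) (\<mu>$i - \<mu>s$i) (u1 E D Pin d \<omega> P i) (u2 E B Pin d \<theta> i)" for i
    define q where "q = (\<Sum>ij\<in>E. (P ij - Ps ij)\<^sup>2 / 2)"
    have L_eq: "L = (\<Sum>i\<in>UNIV. n i) + q" unfolding L lyap_def n_def q_def ..
    have n: "0 \<le> n i \<and> c * (\<eta>$i - \<eta>s$i)\<^sup>2 \<le> n i \<and> c * (d$i - ds$i)\<^sup>2 \<le> n i \<and> c * (\<theta>$i - \<theta>s$i)\<^sup>2 \<le> n i \<and>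
      c * (\<omega>$i - \<omega>s$i)\<^sup>2 \<le> n i \<and> c * (\<mu>$i - \<mu>s$i)\<^sup>2 \<le> n i" for i
    proof (rule weighted_sum_bounds[OF _ c])
      show "\<kappa> / 4 * (\<eta>$i - \<eta>s$i)\<^sup>2 + (1 - \<kappa>) * (d$i - ds$i)\<^sup>2 + (\<theta>$i - \<theta>s$i)\<^sup>2 / 2 + (\<omega>$i - \<omega>s$i)\<^sup>2 / 2
          + (\<mu>$i - \<mu>s$i)\<^sup>2 / 2 \<le> n i"
        unfolding n_def
        using strongly_convex_tangent[OF f0_strongly_convex f0_diff, of i "ds$i" "d$i"]
        by (intro node_energy_lower_bound[OF kappa(1) D_pos beta]) linarith
    qed simp_all
    have q0: "q \<ge> 0" unfolding q_def by (intro sum_nonneg) simp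
    have nL: "n i \<le> L" for i
    proof -
      have "n i \<le> (\<Sum>i\<in>UNIV. n i)" using n by (intro member_le_sum) auto
      then show ?thesis using q0 L_eq by linarith
    qed
    have qL: "q \<le> L" using L_eq sum_nonneg[of UNIV n] n by simp
    have "c * (P ij - Ps ij)\<^sup>2 \<le> L" if "ij \<in> E" for ij
    proof -
      have "c * (P ij - Ps ij)\<^sup>2 \<le> (P ij - Ps ij)\<^sup>2 / 2"
        using mult_right_mono[OF c(4), of "(P ij - Ps ij)\<^sup>2"] by simp
      also have "\<dots> \<le> q" unfolding q_def using that
        by (intro member_le_sum[of ij E "\<lambda>ij. (P ij - Ps ij)\<^sup>2 / 2"]) auto
      finally show ?thesis using qL by simp
    qed
    then show ?thesis using n nL by (blast intro: order_trans)
  qed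
  show ?thesis
    by (rule exI[of _ c], rule conjI[OF c(1)], intro allI, rule main[OF refl])
qed

lemma lyap_nonneg: "lyap \<eta>s ds \<theta>s Ps \<omega>s \<mu>s \<eta> d \<theta> P \<omega> \<mu> \<ge> 0"
proof -
  obtain c where "c > 0" "c * (\<eta>$undefined - \<eta>s$undefined)\<^sup>2 \<le> lyap \<eta>s ds \<theta>s Ps \<omega>s \<mu>s \<eta> d \<theta> P \<omega> \<mu>"
    using lyap_coercive[of \<eta>s ds \<theta>s Ps \<omega>s \<mu>s] by blast
  moreover from this have "c * (\<eta>$undefined - \<eta>s$undefined)\<^sup>2 \<ge> 0" by simp
  ultimately show ?thesis by linarith
qed

lemma lyap_equilibrium:
  "equilibrium \<eta> d \<theta> P \<omega> \<mu> \<Longrightarrow> lyap \<eta> d \<theta> P \<omega> \<mu> \<eta> d \<theta> P \<omega> \<mu> = 0"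
  by (simp add: lyap_def node_energy_def equilibriumD)

lemma dissipation_nonneg: "dissipation \<eta> d \<theta> P \<omega> \<mu> \<ge> 0"
  unfolding dissipation_def using kappa by (intro add_nonneg_nonneg sum_nonneg) auto

lemma dissipation_zero_imp_equilibrium:
  assumes "dissipation \<eta> d \<theta> P \<omega> \<mu> = 0"
  shows "equilibrium \<eta> d \<theta> P \<omega> \<mu>"
proof -
  let ?n = "\<lambda>i. (1 - \<kappa>) / 2 * (rhs_eta f2 \<kappa> \<eta> d i)\<^sup>2
       + (rhs_d E B D Pin f0 dlo dhi \<kappa> \<eta> d \<theta> P \<omega> \<mu> i)\<^sup>2
       + (u1 E D Pin d \<omega> P i)\<^sup>2 / 2 + (u2 E B Pin d \<theta> i)\<^sup>2 / 2 + (rhs_theta E B Pin d \<theta> \<mu> i)\<^sup>2"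
  let ?q = "\<lambda>ij. (rhs_P E D Pin d P \<omega> ij)\<^sup>2"
  have k: "(1 - \<kappa>) / 2 * z\<^sup>2 \<ge> 0" for z using kappa by simp
  have n: "?n i \<ge> 0" for i using k by (intro add_nonneg_nonneg) auto
  have "(\<Sum>i\<in>UNIV. ?n i) \<ge> 0" "(\<Sum>ij\<in>E. ?q ij) \<ge> 0" using n by (auto intro!: sum_nonneg)
  then have "(\<Sum>i\<in>UNIV. ?n i) = 0" "(\<Sum>ij\<in>E. ?q ij) = 0"
    using assms unfolding dissipation_def by linarith+
  then have "\<forall>i\<in>UNIV. ?n i = 0" "\<forall>ij\<in>E. ?q ij = 0"
    using sum_nonneg_eq_0_iff[of UNIV ?n, OF finite n] sum_nonneg_eq_0_iff[of E ?q, OF finite zero_le_power2]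
    by blast+
  then have ni: "?n i = 0" and qi: "ij \<in> E \<Longrightarrow> ?q ij = 0" for i ij by blast+
  have "(1 - \<kappa>) / 2 * (rhs_eta f2 \<kappa> \<eta> d i)\<^sup>2 = 0 \<and> (rhs_d E B D Pin f0 dlo dhi \<kappa> \<eta> d \<theta> P \<omega> \<mu> i)\<^sup>2 = 0
      \<and> (u1 E D Pin d \<omega> P i)\<^sup>2 = 0 \<and> (u2 E B Pin d \<theta> i)\<^sup>2 = 0 \<and> (rhs_theta E B Pin d \<theta> \<mu> i)\<^sup>2 = 0" for i
    using ni[of i] k[of "rhs_eta f2 \<kappa> \<eta> d i"] zero_le_power2[of "rhs_d E B D Pin f0 dlo dhi \<kappa> \<eta> d \<theta> P \<omega> \<mu> i"]
      zero_le_power2[of "u1 E D Pin d \<omega> P i"] zero_le_power2[of "u2 E B Pin d \<theta> i"]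
      zero_le_power2[of "rhs_theta E B Pin d \<theta> \<mu> i"] by linarith
  then show ?thesis
    unfolding dppd_equilibrium_def rhs_lambda_def rhs_mu_def using kappa qi by simp
qed

text \<open>Continuity is stated through filters because \<open>P\<close> is a plain function: its
  convergence is assumed on lines only.\<close>

lemma network_tendsto:
  fixes A :: "'a filter"
  assumes "(\<eta> \<longlongrightarrow> \<eta>s) A" "(d \<longlongrightarrow> ds) A" "(\<theta> \<longlongrightarrow> \<theta>s) A" "(\<omega> \<longlongrightarrow> \<omega>s) A" "(\<mu> \<longlongrightarrow> \<mu>s) A"
    and P: "\<And>ij. ij \<in> E \<Longrightarrow> ((\<lambda>t. P t ij) \<longlongrightarrow> Ps ij) A"
  shows lyap_tendsto: "((\<lambda>t. lyap \<eta>' d' \<theta>' P' \<omega>' \<mu>' (\<eta> t) (d t) (\<theta> t) (P t) (\<omega> t) (\<mu> t))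
      \<longlongrightarrow> lyap \<eta>' d' \<theta>' P' \<omega>' \<mu>' \<eta>s ds \<theta>s Ps \<omega>s \<mu>s) A" (is ?L)
    and dissipation_tendsto: "((\<lambda>t. dissipation (\<eta> t) (d t) (\<theta> t) (P t) (\<omega> t) (\<mu> t))
      \<longlongrightarrow> dissipation \<eta>s ds \<theta>s Ps \<omega>s \<mu>s) A" (is ?D)
proof -
  have comp: "((\<lambda>t. \<eta> t $ i) \<longlongrightarrow> \<eta>s $ i) A" "((\<lambda>t. d t $ i) \<longlongrightarrow> ds $ i) A" "((\<lambda>t. \<theta> t $ i) \<longlongrightarrow> \<theta>s $ i) A"
    "((\<lambda>t. \<omega> t $ i) \<longlongrightarrow> \<omega>s $ i) A" "((\<lambda>t. \<mu> t $ i) \<longlongrightarrow> \<mu>s $ i) A" for i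
    using assms(1-5) by (auto intro: tendsto_vec_nth)
  have f0: "((\<lambda>t. f0 i (d t $ i)) \<longlongrightarrow> f0 i (ds $ i)) A" for i
  proof (rule isCont_tendsto_compose[OF _ comp(2)])
    show "isCont (f0 i) (ds $ i)"
      using f0_diff by (rule differentiable_imp_continuous_within)
  qed
  have df0: "((\<lambda>t. deriv (f0 i) (d t $ i)) \<longlongrightarrow> deriv (f0 i) (ds $ i)) A" for i
    by (rule isCont_tendsto_compose[OF strongly_convex_isCont_deriv[OF f0_strongly_convex] comp(2)])
      (use beta f0_diff in auto)
  have u1: "((\<lambda>t. u1 E D Pin (d t) (\<omega> t) (P t) i) \<longlongrightarrow> u1 E D Pin ds \<omega>s Ps i) A" for i
    unfolding u1_def by (intro tendsto_intros comp line_net_tendsto P)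
  have "((\<lambda>t. lap_flow B (\<lambda>j. \<theta> t $ j) ij) \<longlongrightarrow> lap_flow B (\<lambda>j. \<theta>s $ j) ij) A" for ij
    unfolding lap_flow_def by (cases ij) (auto intro!: tendsto_intros comp)
  then have u2: "((\<lambda>t. u2 E B Pin (d t) (\<theta> t) i) \<longlongrightarrow> u2 E B Pin ds \<theta>s i) A" for i
    unfolding u2_eq by (intro tendsto_intros comp line_net_tendsto)
  have r\<eta>: "((\<lambda>t. rhs_eta f2 \<kappa> (\<eta> t) (d t) i) \<longlongrightarrow> rhs_eta f2 \<kappa> \<eta>s ds i) A" for i
    unfolding rhs_eta_def
    by (rule tendsto_diff[OF isCont_tendsto_compose[OF isCont_prox_convex[OF f2_convex]] comp(2)])
      (intro tendsto_intros comp)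
  have rd: "((\<lambda>t. rhs_d E B D Pin f0 dlo dhi \<kappa> (\<eta> t) (d t) (\<theta> t) (P t) (\<omega> t) (\<mu> t) i)
      \<longlongrightarrow> rhs_d E B D Pin f0 dlo dhi \<kappa> \<eta>s ds \<theta>s Ps \<omega>s \<mu>s i) A" for i
    unfolding rhs_d_eq by (intro tendsto_intros tendsto_max tendsto_min comp df0 u1 u2)
  have r\<theta>: "((\<lambda>t. rhs_theta E B Pin (d t) (\<theta> t) (\<mu> t) i) \<longlongrightarrow> rhs_theta E B Pin ds \<theta>s \<mu>s i) A" for i
    unfolding rhs_theta_def by (intro tendsto_intros comp u2)
  have rP: "((\<lambda>t. rhs_P E D Pin (d t) (P t) (\<omega> t) ij) \<longlongrightarrow> rhs_P E D Pin ds Ps \<omega>s ij) A" for ij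
    unfolding rhs_P_def by (intro tendsto_intros comp u1)
  have half: "((\<lambda>t. y t / 2) \<longlongrightarrow> z / 2) A" if "(y \<longlongrightarrow> z) A" for y :: "'a \<Rightarrow> real" and z
    using that by (rule tendsto_divide[OF _ tendsto_const]) simp
  show ?L unfolding lyap_def
    by (intro tendsto_add[OF tendsto_sum tendsto_sum] node_energy_tendsto half tendsto_power tendsto_diff
        tendsto_mult tendsto_const comp f0 u1 u2 P)
  show ?D unfolding dissipation_def
    by (intro tendsto_add tendsto_sum half tendsto_power tendsto_mult tendsto_const r\<eta> rd u1 u2 r\<theta> rP)
qed

end

subsection \<open>Convergence of trajectories\<close>

locale dppd_solution = dppd_network E B D Pin dlo dhi f0 f2 \<kappa> \<beta>
  for E :: "('n::finite \<times> 'n) set" and B D Pin dlo dhi f0 f2 \<kappa> \<beta> +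
  fixes \<eta> d \<theta> \<omega> \<mu> :: "real \<Rightarrow> real^'n" and P :: "real \<Rightarrow> 'n \<times> 'n \<Rightarrow> real"
  assumes traj: "trajectory \<eta> d \<theta> P \<omega> \<mu>"
begin

text \<open>The equation reads \<open>d' = q - d\<close> with \<open>q\<close> projected onto the
  interval. The integrating factor \<open>exp s\<close> makes the scaled excess over either bound
  nonincreasing.\<close>

lemma box_invariant:
  assumes d0: "d 0 $ i \<in> {dlo i..dhi i}" and t: "t \<ge> 0"
  shows "d t $ i \<in> {dlo i..dhi i}"
proof -
  define q where "q s = rhs_d E B D Pin f0 dlo dhi \<kappa> (\<eta> s) (d s) (\<theta> s) (P s) (\<omega> s) (\<mu> s) i + d s $ i" for s
  have q: "dlo i \<le> q s" "q s \<le> dhi i" for s unfolding q_def rhs_d_eq using box[of i] by auto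
  have dd: "((\<lambda>s. d s $ i) has_real_derivative q s - d s $ i) (at s within {0..})" if "s \<ge> 0" for s
    using traj that unfolding dppd_trajectory_def q_def by auto
  have "exp t * (d t $ i - dhi i) \<le> exp 0 * (d 0 $ i - dhi i) - 0 * (t - 0)"
  proof (rule decrease_at_rate[OF order_refl t])
    fix s :: real assume "0 \<le> s"
    have "((\<lambda>s. exp s * (d s $ i - dhi i)) has_real_derivative exp s * (q s - dhi i)) (at s within {0..})"
      by (auto intro!: derivative_eq_intros dd[OF \<open>0 \<le> s\<close>] simp: algebra_simps)
    moreover have "exp s * (q s - dhi i) \<le> - 0" using q[of s] by (simp add: mult_le_0_iff)
    ultimately show "\<exists>v. ((\<lambda>s. exp s * (d s $ i - dhi i)) has_real_derivative v) (at s within {0..}) \<and> v \<le> - 0"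
      by blast
  qed
  then have "exp t * (d t $ i - dhi i) \<le> 0" using d0 by simp
  then have hi: "d t $ i \<le> dhi i" by (simp add: mult_le_0_iff)
  have "exp t * (dlo i - d t $ i) \<le> exp 0 * (dlo i - d 0 $ i) - 0 * (t - 0)"
  proof (rule decrease_at_rate[OF order_refl t])
    fix s :: real assume "0 \<le> s"
    have "((\<lambda>s. exp s * (dlo i - d s $ i)) has_real_derivative exp s * (dlo i - q s)) (at s within {0..})"
      by (auto intro!: derivative_eq_intros dd[OF \<open>0 \<le> s\<close>] simp: algebra_simps)
    moreover have "exp s * (dlo i - q s) \<le> - 0" using q[of s] by (simp add: mult_le_0_iff)
    ultimately show "\<exists>v. ((\<lambda>s. exp s * (dlo i - d s $ i)) has_real_derivative v) (at s within {0..}) \<and> v \<le> - 0"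
      by blast
  qed
  then have "exp t * (dlo i - d t $ i) \<le> 0" using d0 by simp
  then show ?thesis using hi by (simp add: mult_le_0_iff)
qed

lemma lyap_antimono:
  assumes eq: "equilibrium \<eta>s ds \<theta>s Ps \<omega>s \<mu>s" and st: "0 \<le> s" "s \<le> t"
  shows "lyap \<eta>s ds \<theta>s Ps \<omega>s \<mu>s (\<eta> t) (d t) (\<theta> t) (P t) (\<omega> t) (\<mu> t)
    \<le> lyap \<eta>s ds \<theta>s Ps \<omega>s \<mu>s (\<eta> s) (d s) (\<theta> s) (P s) (\<omega> s) (\<mu> s)"
proof -
  let ?V = "\<lambda>t. lyap \<eta>s ds \<theta>s Ps \<omega>s \<mu>s (\<eta> t) (d t) (\<theta> t) (P t) (\<omega> t) (\<mu> t)"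
  have "?V t \<le> ?V s - 0 * (t - s)"
  proof (rule decrease_at_rate[OF st])
    fix r assume "s \<le> r"
    then obtain v where "(?V has_real_derivative v) (at r within {0..})"
      "v \<le> - dissipation (\<eta> r) (d r) (\<theta> r) (P r) (\<omega> r) (\<mu> r)"
      using lyap_decreasing[OF eq traj, of r] st by auto
    then show "\<exists>v. (?V has_real_derivative v) (at r within {0..}) \<and> v \<le> - 0"
      using dissipation_nonneg[of "\<eta> r" "d r" "\<theta> r" "P r" "\<omega> r" "\<mu> r"] by (intro exI[of _ v]) auto
  qed
  then show ?thesis by simp
qed

lemma trajectory_bounded:
  "\<exists>M. \<forall>t\<ge>0. (\<forall>i. \<bar>\<eta> t $ i\<bar> \<le> M \<and> \<bar>d t $ i\<bar> \<le> M \<and> \<bar>\<theta> t $ i\<bar> \<le> M \<and>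
                        \<bar>\<omega> t $ i\<bar> \<le> M \<and> \<bar>\<mu> t $ i\<bar> \<le> M) \<and> (\<forall>ij\<in>E. \<bar>P t ij\<bar> \<le> M)"
proof -
  obtain \<eta>s ds \<theta>s Ps \<omega>s \<mu>s where eq: "equilibrium \<eta>s ds \<theta>s Ps \<omega>s \<mu>s" using equilibrium_exists by blast
  let ?V = "\<lambda>t. lyap \<eta>s ds \<theta>s Ps \<omega>s \<mu>s (\<eta> t) (d t) (\<theta> t) (P t) (\<omega> t) (\<mu> t)"
  obtain c where c: "c > 0" and co:
    "\<And>t i. c * (\<eta> t $ i - \<eta>s$i)\<^sup>2 \<le> ?V t" "\<And>t i. c * (d t $ i - ds$i)\<^sup>2 \<le> ?V t"
    "\<And>t i. c * (\<theta> t $ i - \<theta>s$i)\<^sup>2 \<le> ?V t" "\<And>t i. c * (\<omega> t $ i - \<omega>s$i)\<^sup>2 \<le> ?V t"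
    "\<And>t i. c * (\<mu> t $ i - \<mu>s$i)\<^sup>2 \<le> ?V t" "\<And>t ij. ij \<in> E \<Longrightarrow> c * (P t ij - Ps ij)\<^sup>2 \<le> ?V t"
    using lyap_coercive[of \<eta>s ds \<theta>s Ps \<omega>s \<mu>s] by blast
  \<comment> \<open>By coercivity, the radius of the sublevel set containing the trajectory.\<close>
  define K where "K = sqrt (?V 0 / c)"
  have K: "\<bar>y\<bar> \<le> K + \<bar>z\<bar>" if "c * (y - z)\<^sup>2 \<le> ?V t" "t \<ge> 0" for y z t
  proof -
    have "(y - z)\<^sup>2 \<le> ?V 0 / c"
      using that lyap_antimono[OF eq order_refl that(2)] c by (simp add: field_simps)
    then have "\<bar>y - z\<bar> \<le> K" unfolding K_def using real_sqrt_le_mono by fastforce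
    then show ?thesis by linarith
  qed
  define M where "M = K + norm \<eta>s + norm ds + norm \<theta>s + norm \<omega>s + norm \<mu>s + (\<Sum>ij\<in>E. \<bar>Ps ij\<bar>)"
  have S0: "(\<Sum>ij\<in>E. \<bar>Ps ij\<bar>) \<ge> 0" by (simp add: sum_nonneg)
  have n0: "norm \<eta>s \<ge> 0" "norm ds \<ge> 0" "norm \<theta>s \<ge> 0" "norm \<omega>s \<ge> 0" "norm \<mu>s \<ge> 0" by auto
  have comp: "\<bar>y\<bar> \<le> M" if "c * (y - v $ i)\<^sup>2 \<le> ?V t" "t \<ge> 0" "norm v \<le> M - K" for y t i and v :: "real^'n"
    using K[OF that(1,2)] component_le_norm_cart[of v i] that(3) by linarith
  have "\<bar>\<eta> t $ i\<bar> \<le> M \<and> \<bar>d t $ i\<bar> \<le> M \<and> \<bar>\<theta> t $ i\<bar> \<le> M \<and> \<bar>\<omega> t $ i\<bar> \<le> M \<and> \<bar>\<mu> t $ i\<bar> \<le> M"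
    if t: "t \<ge> 0" for t i
    using comp[OF co(1) t] comp[OF co(2) t] comp[OF co(3) t] comp[OF co(4) t] comp[OF co(5) t] S0 n0
    unfolding M_def by simp
  moreover have "\<bar>P t ij\<bar> \<le> M" if t: "t \<ge> 0" and ij: "ij \<in> E" for t ij
  proof -
    have "\<bar>Ps ij\<bar> \<le> (\<Sum>ij\<in>E. \<bar>Ps ij\<bar>)" using ij by (intro member_le_sum) auto
    then show ?thesis using K[OF co(6)[OF ij] t] n0 unfolding M_def by linarith
  qed
  ultimately show ?thesis by blast
qed

text \<open>Otherwise the Lyapunov function would lose at least \<open>\<epsilon>\<close> per unit
  time forever and become negative.\<close>

lemma dissipation_liminf_zero:
  assumes "\<epsilon> > 0" "T \<ge> 0"
  shows "\<exists>t\<ge>T. dissipation (\<eta> t) (d t) (\<theta> t) (P t) (\<omega> t) (\<mu> t) < \<epsilon>"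
proof (rule ccontr)
  assume neg: "\<not> ?thesis"
  obtain \<eta>s ds \<theta>s Ps \<omega>s \<mu>s where eq: "equilibrium \<eta>s ds \<theta>s Ps \<omega>s \<mu>s" using equilibrium_exists by blast
  let ?V = "\<lambda>t. lyap \<eta>s ds \<theta>s Ps \<omega>s \<mu>s (\<eta> t) (d t) (\<theta> t) (P t) (\<omega> t) (\<mu> t)"
  \<comment> \<open>Long enough after \<open>T\<close> for a loss of \<open>?V T + 1\<close> at rate
    \<open>\<epsilon>\<close>.\<close>
  define t where "t = T + (?V T + 1) / \<epsilon>"
  have V0: "?V T \<ge> 0" by (rule lyap_nonneg)
  then have tT: "T \<le> t" unfolding t_def using assms by simp
  have "?V t \<le> ?V T - \<epsilon> * (t - T)"
  proof (rule decrease_at_rate[OF assms(2) tT])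
    fix r assume r: "T \<le> r"
    then have "dissipation (\<eta> r) (d r) (\<theta> r) (P r) (\<omega> r) (\<mu> r) \<ge> \<epsilon>" using neg by (simp add: not_less)
    moreover obtain v where "(?V has_real_derivative v) (at r within {0..})"
      "v \<le> - dissipation (\<eta> r) (d r) (\<theta> r) (P r) (\<omega> r) (\<mu> r)"
      using lyap_decreasing[OF eq traj, of r] r assms(2) by auto
    ultimately show "\<exists>v. (?V has_real_derivative v) (at r within {0..}) \<and> v \<le> - \<epsilon>"
      by (intro exI[of _ v]) auto
  qed
  moreover have "\<epsilon> * (t - T) = ?V T + 1" unfolding t_def using assms by simp
  ultimately have "?V t < 0" by linarith
  then show False using lyap_nonneg[of \<eta>s ds \<theta>s Ps \<omega>s \<mu>s] by (simp add: not_less[symmetric])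
qed

lemma equilibrium_limit_point:
  obtains \<tau> \<eta>s ds \<theta>s Ps \<omega>s \<mu>s where "\<And>k::nat. \<tau> k \<ge> 0" "equilibrium \<eta>s ds \<theta>s Ps \<omega>s \<mu>s"
    "(\<lambda>k. lyap \<eta>s ds \<theta>s Ps \<omega>s \<mu>s (\<eta> (\<tau> k)) (d (\<tau> k)) (\<theta> (\<tau> k)) (P (\<tau> k)) (\<omega> (\<tau> k)) (\<mu> (\<tau> k)))
       \<longlonglongrightarrow> 0"
proof -
  \<comment> \<open>Only small dissipation is asked of these times, not growth: antitonicity later
    carries smallness of the Lyapunov function to all subsequent times.\<close>
  have "\<forall>k::nat. \<exists>t\<ge>0. dissipation (\<eta> t) (d t) (\<theta> t) (P t) (\<omega> t) (\<mu> t) < 1 / real (Suc k)"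
    using dissipation_liminf_zero[OF _ order_refl] by simp
  then obtain \<sigma> where \<sigma>: "\<And>k. \<sigma> k \<ge> 0"
    and diss: "\<And>k. dissipation (\<eta> (\<sigma> k)) (d (\<sigma> k)) (\<theta> (\<sigma> k)) (P (\<sigma> k)) (\<omega> (\<sigma> k)) (\<mu> (\<sigma> k)) < 1 / real (Suc k)"
    by metis
  obtain M where M: "\<And>t i. t \<ge> 0 \<Longrightarrow> \<bar>\<eta> t $ i\<bar> \<le> M \<and> \<bar>d t $ i\<bar> \<le> M \<and> \<bar>\<theta> t $ i\<bar> \<le> M \<and>
                        \<bar>\<omega> t $ i\<bar> \<le> M \<and> \<bar>\<mu> t $ i\<bar> \<le> M" "\<And>t ij. t \<ge> 0 \<Longrightarrow> ij \<in> E \<Longrightarrow> \<bar>P t ij\<bar> \<le> M"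
    using trajectory_bounded by blast
  have M0: "M \<ge> 0" using M(1)[of 0 undefined] by linarith
  \<comment> \<open>\<open>P\<close> is uncontrolled off \<open>E\<close>, so it is truncated there before compactness is applied.\<close>
  define Q where "Q t = (\<chi> ij. if ij \<in> E then P t ij else 0)" for t
  define Z where "Z k = (\<eta> (\<sigma> k), d (\<sigma> k), \<theta> (\<sigma> k), \<omega> (\<sigma> k), \<mu> (\<sigma> k), Q (\<sigma> k))" for k
  let ?S = "{x :: real^'n. \<forall>i. \<bar>x $ i\<bar> \<le> M}" and ?S' = "{x :: real^('n \<times> 'n). \<forall>i. \<bar>x $ i\<bar> \<le> M}"
  have "range Z \<subseteq> ?S \<times> ?S \<times> ?S \<times> ?S \<times> ?S \<times> ?S'"
    using M \<sigma> M0 by (auto simp: Z_def Q_def)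
  moreover have "bounded (?S \<times> ?S \<times> ?S \<times> ?S \<times> ?S \<times> ?S')"
    by (intro bounded_Times bounded_vec_box)
  ultimately have "bounded (range Z)" by (rule bounded_subset[rotated])
  then obtain z r where r: "strict_mono r" and lim: "(Z \<circ> r) \<longlonglongrightarrow> z"
    using bounded_imp_convergent_subsequence by blast
  obtain \<eta>s ds \<theta>s \<omega>s \<mu>s Qs where z: "z = (\<eta>s, ds, \<theta>s, \<omega>s, \<mu>s, Qs)" by (cases z) auto
  define \<tau> where "\<tau> k = \<sigma> (r k)" for k
  have Z: "(\<lambda>k. (\<eta> (\<tau> k), d (\<tau> k), \<theta> (\<tau> k), \<omega> (\<tau> k), \<mu> (\<tau> k), Q (\<tau> k))) \<longlonglongrightarrow> (\<eta>s, ds, \<theta>s, \<omega>s, \<mu>s, Qs)"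
    using lim unfolding z Z_def \<tau>_def comp_def .
  note s1 = tendsto_snd[OF Z, simplified]
  note s2 = tendsto_snd[OF s1, simplified]
  note s3 = tendsto_snd[OF s2, simplified]
  note s4 = tendsto_snd[OF s3, simplified]
  note s5 = tendsto_snd[OF s4, simplified]
  note lims = tendsto_fst[OF Z, simplified] tendsto_fst[OF s1, simplified] tendsto_fst[OF s2, simplified]
    tendsto_fst[OF s3, simplified] tendsto_fst[OF s4, simplified]
  have limP: "(\<lambda>k. P (\<tau> k) ij) \<longlonglongrightarrow> Qs $ ij" if "ij \<in> E" for ij
    using tendsto_vec_nth[OF s5, of ij] that by (simp add: Q_def)
  let ?d = "\<lambda>k. dissipation (\<eta> (\<tau> k)) (d (\<tau> k)) (\<theta> (\<tau> k)) (P (\<tau> k)) (\<omega> (\<tau> k)) (\<mu> (\<tau> k))"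
  have "?d \<longlonglongrightarrow> dissipation \<eta>s ds \<theta>s (\<lambda>ij. Qs $ ij) \<omega>s \<mu>s"
    by (rule dissipation_tendsto[OF lims]) (rule limP)
  moreover have "?d \<longlonglongrightarrow> 0"
  proof (rule tendsto_sandwich[OF _ _ tendsto_const LIMSEQ_inverse_real_of_nat])
    show "\<forall>\<^sub>F k in sequentially. 0 \<le> ?d k" by (simp add: dissipation_nonneg)
    have "?d k \<le> inverse (real (Suc k))" for k
    proof -
      have "?d k \<le> 1 / real (Suc (r k))" using diss[of "r k"] unfolding \<tau>_def by simp
      also have "\<dots> \<le> 1 / real (Suc k)"
        using seq_suble[OF r, of k] by (intro divide_left_mono) auto
      finally show ?thesis by (simp add: inverse_eq_divide)
    qed
    then show "\<forall>\<^sub>F k in sequentially. ?d k \<le> inverse (real (Suc k))" by simp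
  qed
  ultimately have "dissipation \<eta>s ds \<theta>s (\<lambda>ij. Qs $ ij) \<omega>s \<mu>s = 0" by (rule LIMSEQ_unique)
  then have eq: "equilibrium \<eta>s ds \<theta>s (\<lambda>ij. Qs $ ij) \<omega>s \<mu>s" by (rule dissipation_zero_imp_equilibrium)
  have "(\<lambda>k. lyap \<eta>s ds \<theta>s (\<lambda>ij. Qs $ ij) \<omega>s \<mu>s (\<eta> (\<tau> k)) (d (\<tau> k)) (\<theta> (\<tau> k)) (P (\<tau> k)) (\<omega> (\<tau> k)) (\<mu> (\<tau> k)))
       \<longlonglongrightarrow> lyap \<eta>s ds \<theta>s (\<lambda>ij. Qs $ ij) \<omega>s \<mu>s \<eta>s ds \<theta>s (\<lambda>ij. Qs $ ij) \<omega>s \<mu>s"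
    by (rule lyap_tendsto[OF lims]) (rule limP)
  from that[OF _ eq this[unfolded lyap_equilibrium[OF eq]]] show ?thesis using \<sigma> unfolding \<tau>_def by blast
qed

lemma convergence:
  "\<exists>\<eta>s ds \<theta>s \<omega>s \<mu>s Ps. equilibrium \<eta>s ds \<theta>s Ps \<omega>s \<mu>s \<and>
     (\<eta> \<longlongrightarrow> \<eta>s) at_top \<and> (d \<longlongrightarrow> ds) at_top \<and> (\<theta> \<longlongrightarrow> \<theta>s) at_top \<and>
     (\<omega> \<longlongrightarrow> \<omega>s) at_top \<and> (\<mu> \<longlongrightarrow> \<mu>s) at_top \<and> (\<forall>ij\<in>E. ((\<lambda>t. P t ij) \<longlongrightarrow> Ps ij) at_top)"
proof (rule equilibrium_limit_point)
  fix \<tau> \<eta>s ds \<theta>s Ps \<omega>s \<mu>s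
  assume \<tau>: "\<And>k::nat. \<tau> k \<ge> 0" and eq: "equilibrium \<eta>s ds \<theta>s Ps \<omega>s \<mu>s"
    and lim: "(\<lambda>k. lyap \<eta>s ds \<theta>s Ps \<omega>s \<mu>s (\<eta> (\<tau> k)) (d (\<tau> k)) (\<theta> (\<tau> k)) (P (\<tau> k)) (\<omega> (\<tau> k)) (\<mu> (\<tau> k)))
       \<longlonglongrightarrow> 0"
  define V where "V t = lyap \<eta>s ds \<theta>s Ps \<omega>s \<mu>s (\<eta> t) (d t) (\<theta> t) (P t) (\<omega> t) (\<mu> t)" for t
  have V: "(V \<longlongrightarrow> 0) at_top"
  proof (rule order_tendstoI)
    fix y :: real assume "y < 0"
    then have "y < V t" for t unfolding V_def by (rule less_le_trans) (rule lyap_nonneg)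
    then show "eventually (\<lambda>t. y < V t) at_top" by simp
  next
    fix y :: real assume "0 < y"
    then have "eventually (\<lambda>k. V (\<tau> k) < y) sequentially"
      using order_tendstoD(2)[OF lim] unfolding V_def by blast
    then obtain k where k: "V (\<tau> k) < y" using eventually_happens by force
    have "V t < y" if "t \<ge> \<tau> k" for t
      using lyap_antimono[OF eq \<tau> that] k unfolding V_def by linarith
    then show "eventually (\<lambda>t. V t < y) at_top" unfolding eventually_at_top_linorder by blast
  qed
  obtain c where c: "c > 0" and co:
    "\<And>t i. c * (\<eta> t $ i - \<eta>s$i)\<^sup>2 \<le> V t" "\<And>t i. c * (d t $ i - ds$i)\<^sup>2 \<le> V t"
    "\<And>t i. c * (\<theta> t $ i - \<theta>s$i)\<^sup>2 \<le> V t" "\<And>t i. c * (\<omega> t $ i - \<omega>s$i)\<^sup>2 \<le> V t"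
    "\<And>t i. c * (\<mu> t $ i - \<mu>s$i)\<^sup>2 \<le> V t" "\<And>t ij. ij \<in> E \<Longrightarrow> c * (P t ij - Ps ij)\<^sup>2 \<le> V t"
    using lyap_coercive[of \<eta>s ds \<theta>s Ps \<omega>s \<mu>s] unfolding V_def by blast
  note conv = tendsto_of_square_bound[OF c V always_eventually[OF allI]]
  have lim1: "(\<eta> \<longlongrightarrow> \<eta>s) at_top" by (rule vec_tendstoI) (rule conv[OF co(1)])
  have lim2: "(d \<longlongrightarrow> ds) at_top" by (rule vec_tendstoI) (rule conv[OF co(2)])
  have lim3: "(\<theta> \<longlongrightarrow> \<theta>s) at_top" by (rule vec_tendstoI) (rule conv[OF co(3)])
  have lim4: "(\<omega> \<longlongrightarrow> \<omega>s) at_top" by (rule vec_tendstoI) (rule conv[OF co(4)])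
  have lim5: "(\<mu> \<longlongrightarrow> \<mu>s) at_top" by (rule vec_tendstoI) (rule conv[OF co(5)])
  have lim6: "\<forall>ij\<in>E. ((\<lambda>t. P t ij) \<longlongrightarrow> Ps ij) at_top" by (rule ballI) (rule conv[OF co(6)])
  show ?thesis
    by (rule exI[of _ \<eta>s], rule exI[of _ ds], rule exI[of _ \<theta>s], rule exI[of _ \<omega>s], rule exI[of _ \<mu>s],
        rule exI[of _ Ps]) (intro conjI eq lim1 lim2 lim3 lim4 lim5 lim6)
qed

end

theorem theorem2:
  fixes E :: "('n::finite \<times> 'n) set"
    and B :: "'n \<times> 'n \<Rightarrow> real" and D Pin dlo dhi :: "'n \<Rightarrow> real"
    and f0 f2 :: "'n \<Rightarrow> real \<Rightarrow> real"
    and \<kappa> \<beta> :: real and Plo Phi :: "'n \<times> 'n \<Rightarrow> real"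
    and \<eta> d \<theta> \<omega> \<mu> :: "real \<Rightarrow> real^'n" and P :: "real \<Rightarrow> 'n \<times> 'n \<Rightarrow> real"
  assumes conn: "weakly_connected E"
    and B_pos: "\<forall>ij\<in>E. B ij > 0"
    and D_pos: "\<forall>i. D i > 0"
    and kappa: "0 < \<kappa>" "\<kappa> < 1"
    and f0_diff: "\<forall>i x. f0 i differentiable (at x)"
    and f2_convex: "\<forall>i. convex_on UNIV (f2 i)"
    and f2_lsc: "\<forall>i. lsc (f2 i)"
    and A1: "\<beta> > 1" "\<forall>i. strongly_convex \<beta> (f0 i)"
    and limits: "\<forall>ij\<in>E. Plo ij \<le> Phi ij"
    and A2: "\<exists>dt \<theta>t :: real^'n.
               dt \<in> rel_interior {x. \<forall>i. x$i \<in> {dlo i..dhi i}} \<and>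
               (\<forall>i. u2 E B Pin dt \<theta>t i = 0) \<and>
               (\<forall>ij\<in>E. Plo ij < B ij * (\<theta>t$(fst ij) - \<theta>t$(snd ij)) \<and>
                        B ij * (\<theta>t$(fst ij) - \<theta>t$(snd ij)) < Phi ij)"
    and traj: "dppd_trajectory E B D Pin f0 f2 dlo dhi \<kappa> \<eta> d \<theta> P \<omega> \<mu>"
  shows
    "((\<forall>i. d 0 $ i \<in> {dlo i..dhi i}) \<longrightarrow> (\<forall>i. \<forall>t\<ge>0. d t $ i \<in> {dlo i..dhi i})) \<and>
     (\<exists>M. \<forall>t\<ge>0. (\<forall>i. \<bar>\<eta> t $ i\<bar> \<le> M \<and> \<bar>d t $ i\<bar> \<le> M \<and> \<bar>\<theta> t $ i\<bar> \<le> M \<and>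
                        \<bar>\<omega> t $ i\<bar> \<le> M \<and> \<bar>\<mu> t $ i\<bar> \<le> M) \<and>
                 (\<forall>ij\<in>E. \<bar>P t ij\<bar> \<le> M)) \<and>
     (\<exists>\<eta>s ds \<theta>s \<omega>s \<mu>s :: real^'n. \<exists>Ps :: 'n \<times> 'n \<Rightarrow> real.
        dppd_equilibrium E B D Pin f0 f2 dlo dhi \<kappa> \<eta>s ds \<theta>s Ps \<omega>s \<mu>s \<and>
        rolc_optimal E B D Pin f0 f2 dlo dhi ds \<theta>s Ps \<omega>s \<and>
        (\<eta> \<longlongrightarrow> \<eta>s) at_top \<and> (d \<longlongrightarrow> ds) at_top \<and> (\<theta> \<longlongrightarrow> \<theta>s) at_top \<and>
        (\<omega> \<longlongrightarrow> \<omega>s) at_top \<and> (\<mu> \<longlongrightarrow> \<mu>s) at_top \<and>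
        (\<forall>ij\<in>E. ((\<lambda>t. P t ij) \<longlongrightarrow> Ps ij) at_top))"
proof -
  obtain dt \<theta>t :: "real^'n" where "dt \<in> rel_interior {x. \<forall>i. x$i \<in> {dlo i..dhi i}}"
    and bal: "\<And>i. u2 E B Pin dt \<theta>t i = 0"
    using A2 by blast
  then have dt: "dlo i \<le> dt $ i" "dt $ i \<le> dhi i" for i using rel_interior_subset by fastforce+
  \<comment> \<open>Line flows cancel in the total, so the Slater point shows that the total
    injection equals a demand total attained inside the box; this is
    \<open>capacity\<close>.\<close>
  have "(\<Sum>i\<in>UNIV. u2 E B Pin dt \<theta>t i) = (\<Sum>i\<in>UNIV. Pin i) - (\<Sum>i\<in>UNIV. dt $ i)"
    unfolding u2_def by (simp add: sum.distrib sum_subtractf sum_line_net)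
  then have sum: "(\<Sum>i\<in>UNIV. Pin i) = (\<Sum>i\<in>UNIV. dt $ i)" using bal by simp
  interpret dppd_solution E B D Pin dlo dhi f0 f2 \<kappa> \<beta> \<eta> d \<theta> \<omega> \<mu> P
  proof unfold_locales
    show "dlo i \<le> dhi i" for i using dt[of i] by linarith
    show "(\<Sum>i\<in>UNIV. dlo i) \<le> (\<Sum>i\<in>UNIV. Pin i)" "(\<Sum>i\<in>UNIV. Pin i) \<le> (\<Sum>i\<in>UNIV. dhi i)"
      unfolding sum using dt by (auto intro: sum_mono)
  qed (use assms in auto)
  show ?thesis
  proof (intro conjI impI allI)
    show "d t $ i \<in> {dlo i..dhi i}" if "\<forall>i. d 0 $ i \<in> {dlo i..dhi i}" "0 \<le> t" for i t
      using box_invariant that by blast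
  next
    obtain \<eta>s ds \<theta>s \<omega>s \<mu>s Ps where
      eq: "dppd_equilibrium E B D Pin f0 f2 dlo dhi \<kappa> \<eta>s ds \<theta>s Ps \<omega>s \<mu>s"
      and lim: "(\<eta> \<longlongrightarrow> \<eta>s) at_top" "(d \<longlongrightarrow> ds) at_top" "(\<theta> \<longlongrightarrow> \<theta>s) at_top"
        "(\<omega> \<longlongrightarrow> \<omega>s) at_top" "(\<mu> \<longlongrightarrow> \<mu>s) at_top" "\<forall>ij\<in>E. ((\<lambda>t. P t ij) \<longlongrightarrow> Ps ij) at_top"
      using convergence by (elim exE conjE) (rule that)
    show "\<exists>\<eta>s ds \<theta>s \<omega>s \<mu>s :: real^'n. \<exists>Ps :: 'n \<times> 'n \<Rightarrow> real.
        dppd_equilibrium E B D Pin f0 f2 dlo dhi \<kappa> \<eta>s ds \<theta>s Ps \<omega>s \<mu>s \<and>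
        rolc_optimal E B D Pin f0 f2 dlo dhi ds \<theta>s Ps \<omega>s \<and>
        (\<eta> \<longlongrightarrow> \<eta>s) at_top \<and> (d \<longlongrightarrow> ds) at_top \<and> (\<theta> \<longlongrightarrow> \<theta>s) at_top \<and>
        (\<omega> \<longlongrightarrow> \<omega>s) at_top \<and> (\<mu> \<longlongrightarrow> \<mu>s) at_top \<and>
        (\<forall>ij\<in>E. ((\<lambda>t. P t ij) \<longlongrightarrow> Ps ij) at_top)"
      by (intro exI conjI) (rule eq equilibrium_imp_optimal[OF eq] lim)+
  qed (rule trajectory_bounded)
qed

end
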